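(* Let $\mathbb{C}$ be a Goursat category, $R$ and $S$ two equivalence relations on an object $X$ of $\mathbb{C}$, and let $f: X \twoheadrightarrow Y$ be a regular epimorphism. If there exists a connector between $R$ and $S$, then there exists a connector between the regular images $f(R)$ and $f(S)$.
   Context: A category is regular if it is finitely complete, regular epimorphisms are stable under pullbacks, and kernel pairs have coequalisers. A relation from $X$ to $Y$ is a subobject $\langle r_1,r_2\rangle : R \rightarrowtail X\times Y$; in a regular category the composite $SR$ of $R\rightarrowtail X\times Y$ and $S\rightarrowtail Y\times Z$ is the image of $(r_1 p_1, s_2 p_2): R\times_Y S\to X\times Z$, where $R\times_Y S$ (with projections $p_1,p_2$) is the pullback of $r_2$ along $s_1$. An equivalence relation on $X$ is a relation from $X$ to $X$ that is (internally) reflexive, symmetric and transitive. A Goursat category is a regular category in which $RSR=SRS$ for any pair of equivalence relations $R,S$ on the same object. For an equivalence relation $(R,r_1,r_2)$ on $X$ and a regular epimorphism $f:X\twoheadrightarrow Y$, the regular image $f(R)$ of $R$ along $f$ is the relation on $Y$ given by the monomorphism in the (regular epimorphism, monomorphism) factorisation of $(f\times f)\circ\langle r_1,r_2\rangle: R\to Y\times Y$. Known fact: a regular category is a Goursat category if and only if all such regular images of equivalence relations are equivalence relations; so here $f(R)$ and $f(S)$ are equivalence relations on $Y$. Let $(R,r_1,r_2)$ and $(S,s_1,s_2)$ be equivalence relations on an object $X$, and let $R\times_X S$ be the pullback of $r_2$ along $s_1$ (so its generalized elements are triples $(x,y,z)$ with $xRy$ and $ySz$). A connector between $R$ and $S$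 is an arrow $p: R\times_X S\to X$ such that (in terms of generalized elements, whenever each term is defined): (1) $x\,S\,p(x,y,z)\,R\,z$; (2) $p(x,x,y)=y$; (3) $p(x,y,y)=x$; (4) $p(x,y,p(z,u,v))=p(p(x,y,z),u,v)$. *)

theory Defs
  imports Main
begin

section \<open>Categories and finite limits\<close>

record ('o, 'a) cat =
  Ob  :: "'o set"
  Ar  :: "'a set"
  Dom :: "'a \<Rightarrow> 'o"
  Cod :: "'a \<Rightarrow> 'o"
  Idt :: "'o \<Rightarrow> 'a"
  Cmp :: "'a \<Rightarrow> 'a \<Rightarrow> 'a" (infixr "\<cdot>\<index>" 75)

text \<open>Composition is written in applicative order (\<open>g \<cdot> f\<close> is \<open>f\<close> followed by \<open>g\<close>) and is
  only meaningful on composable arrows of \<open>Ar C\<close>.\<close>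

definition hom :: "('o, 'a) cat \<Rightarrow> 'o \<Rightarrow> 'o \<Rightarrow> 'a set" where
  "hom C X Y = {f \<in> Ar C. Dom C f = X \<and> Cod C f = Y}"

locale category =
  fixes C :: "('o, 'a) cat" (structure)
  assumes Dom_Ob: "f \<in> Ar C \<Longrightarrow> Dom C f \<in> Ob C"
    and Cod_Ob: "f \<in> Ar C \<Longrightarrow> Cod C f \<in> Ob C"
    and Idt_hom: "X \<in> Ob C \<Longrightarrow> Idt C X \<in> hom C X X"
    and Cmp_hom: "\<lbrakk>f \<in> hom C X Y; g \<in> hom C Y Z\<rbrakk> \<Longrightarrow> g \<cdot> f \<in> hom C X Z"
    and Cmp_Idt: "f \<in> hom C X Y \<Longrightarrow> f \<cdot> Idt C X = f"
    and Idt_Cmp: "f \<in> hom C X Y \<Longrightarrow> Idt C Y \<cdot> f = f"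
    and Cmp_assoc: "\<lbrakk>f \<in> hom C W X; g \<in> hom C X Y; h \<in> hom C Y Z\<rbrakk>
      \<Longrightarrow> (h \<cdot> g) \<cdot> f = h \<cdot> (g \<cdot> f)"

definition is_functor ::
  "('i, 'j) cat \<Rightarrow> ('o, 'a) cat \<Rightarrow> ('i \<Rightarrow> 'o) \<Rightarrow> ('j \<Rightarrow> 'a) \<Rightarrow> bool" where
  "is_functor J C Fo Fa \<longleftrightarrow>
     (\<forall>i\<in>Ob J. Fo i \<in> Ob C \<and> Fa (Idt J i) = Idt C (Fo i)) \<and>
     (\<forall>a\<in>Ar J. Fa a \<in> hom C (Fo (Dom J a)) (Fo (Cod J a))) \<and>
     (\<forall>a\<in>Ar J. \<forall>b\<in>Ar J. Cod J a = Dom J b \<longrightarrow> Fa (b \<cdot>\<^bsub>J\<^esub> a) = Fa b \<cdot>\<^bsub>C\<^esub> Fa a)"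

definition is_cone ::
  "('i, 'j) cat \<Rightarrow> ('o, 'a) cat \<Rightarrow> ('i \<Rightarrow> 'o) \<Rightarrow> ('j \<Rightarrow> 'a) \<Rightarrow> 'o \<Rightarrow> ('i \<Rightarrow> 'a) \<Rightarrow> bool" where
  "is_cone J C Fo Fa L c \<longleftrightarrow>
     L \<in> Ob C \<and>
     (\<forall>i\<in>Ob J. c i \<in> hom C L (Fo i)) \<and>
     (\<forall>a\<in>Ar J. Fa a \<cdot>\<^bsub>C\<^esub> c (Dom J a) = c (Cod J a))"

definition is_limit ::
  "('i, 'j) cat \<Rightarrow> ('o, 'a) cat \<Rightarrow> ('i \<Rightarrow> 'o) \<Rightarrow> ('j \<Rightarrow> 'a) \<Rightarrow> 'o \<Rightarrow> ('i \<Rightarrow> 'a) \<Rightarrow> bool" where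
  "is_limit J C Fo Fa L c \<longleftrightarrow>
     is_cone J C Fo Fa L c \<and>
     (\<forall>M d. is_cone J C Fo Fa M d \<longrightarrow>
        (\<exists>!h. h \<in> hom C M L \<and> (\<forall>i\<in>Ob J. c i \<cdot>\<^bsub>C\<^esub> h = d i)))"

text \<open>Every finite category is isomorphic to one whose objects and arrows are natural numbers,
  so restricting the index categories to \<open>nat\<close> loses no finite diagram.\<close>

definition finitely_complete :: "('o, 'a) cat \<Rightarrow> bool" where
  "finitely_complete C \<longleftrightarrow>
     (\<forall>(J :: (nat, nat) cat) Fo Fa.
        category J \<and> finite (Ob J) \<and> finite (Ar J) \<and> is_functor J C Fo Fa \<longrightarrow>
        (\<exists>L c. is_limit J C Fo Fa L c))"

text \<open>Products and pullbacks are given by their projections; the apex is the common domain.\<close>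

definition is_product :: "('o, 'a) cat \<Rightarrow> 'o \<Rightarrow> 'o \<Rightarrow> 'a \<Rightarrow> 'a \<Rightarrow> bool" where
  "is_product C X Y q1 q2 \<longleftrightarrow>
     q1 \<in> hom C (Dom C q1) X \<and> q2 \<in> hom C (Dom C q1) Y \<and>
     (\<forall>T. \<forall>a\<in>hom C T X. \<forall>b\<in>hom C T Y.
        \<exists>!h. h \<in> hom C T (Dom C q1) \<and> q1 \<cdot>\<^bsub>C\<^esub> h = a \<and> q2 \<cdot>\<^bsub>C\<^esub> h = b)"

definition is_pullback :: "('o, 'a) cat \<Rightarrow> 'a \<Rightarrow> 'a \<Rightarrow> 'a \<Rightarrow> 'a \<Rightarrow> bool" where
  "is_pullback C f g p1 p2 \<longleftrightarrow>
     f \<in> Ar C \<and> g \<in> Ar C \<and> Cod C f = Cod C g \<and>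
     p1 \<in> hom C (Dom C p1) (Dom C f) \<and> p2 \<in> hom C (Dom C p1) (Dom C g) \<and>
     f \<cdot>\<^bsub>C\<^esub> p1 = g \<cdot>\<^bsub>C\<^esub> p2 \<and>
     (\<forall>T. \<forall>a\<in>hom C T (Dom C f). \<forall>b\<in>hom C T (Dom C g). f \<cdot>\<^bsub>C\<^esub> a = g \<cdot>\<^bsub>C\<^esub> b \<longrightarrow>
        (\<exists>!h. h \<in> hom C T (Dom C p1) \<and> p1 \<cdot>\<^bsub>C\<^esub> h = a \<and> p2 \<cdot>\<^bsub>C\<^esub> h = b))"

definition is_coequalizer :: "('o, 'a) cat \<Rightarrow> 'a \<Rightarrow> 'a \<Rightarrow> 'a \<Rightarrow> bool" where
  "is_coequalizer C u v e \<longleftrightarrow>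
     u \<in> Ar C \<and> v \<in> hom C (Dom C u) (Cod C u) \<and> e \<in> hom C (Cod C u) (Cod C e) \<and>
     e \<cdot>\<^bsub>C\<^esub> u = e \<cdot>\<^bsub>C\<^esub> v \<and>
     (\<forall>T. \<forall>a\<in>hom C (Cod C u) T. a \<cdot>\<^bsub>C\<^esub> u = a \<cdot>\<^bsub>C\<^esub> v \<longrightarrow>
        (\<exists>!h. h \<in> hom C (Cod C e) T \<and> h \<cdot>\<^bsub>C\<^esub> e = a))"

definition mono_arr :: "('o, 'a) cat \<Rightarrow> 'a \<Rightarrow> bool" where
  "mono_arr C m \<longleftrightarrow>
     m \<in> Ar C \<and>
     (\<forall>T. \<forall>a\<in>hom C T (Dom C m). \<forall>b\<in>hom C T (Dom C m). m \<cdot>\<^bsub>C\<^esub> a = m \<cdot>\<^bsub>C\<^esub> b \<longrightarrow> a = b)"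

definition iso_arr :: "('o, 'a) cat \<Rightarrow> 'a \<Rightarrow> bool" where
  "iso_arr C i \<longleftrightarrow>
     i \<in> Ar C \<and>
     (\<exists>j\<in>hom C (Cod C i) (Dom C i).
        j \<cdot>\<^bsub>C\<^esub> i = Idt C (Dom C i) \<and> i \<cdot>\<^bsub>C\<^esub> j = Idt C (Cod C i))"

definition regular_epi :: "('o, 'a) cat \<Rightarrow> 'a \<Rightarrow> bool" where
  "regular_epi C e \<longleftrightarrow> (\<exists>u v. is_coequalizer C u v e)"

locale regular_category = category C for C :: "('o, 'a) cat" (structure) +
  assumes finitely_complete: "finitely_complete C"
    and regular_epi_stable:
      "\<lbrakk>is_pullback C f g p1 p2; regular_epi C g\<rbrakk> \<Longrightarrow> regular_epi C p1"
    and kernel_pair_coequalizer: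
      "is_pullback C f f u v \<Longrightarrow> \<exists>e. is_coequalizer C u v e"


section \<open>Relations\<close>

text \<open>\<open>m\<close> is the mono part of a (regular epi, mono) factorisation of \<open>h\<close>.\<close>

definition is_image :: "('o, 'a) cat \<Rightarrow> 'a \<Rightarrow> 'a \<Rightarrow> bool" where
  "is_image C h m \<longleftrightarrow>
     mono_arr C m \<and> (\<exists>e. regular_epi C e \<and> Cod C e = Dom C m \<and> h = m \<cdot>\<^bsub>C\<^esub> e)"

text \<open>A relation is represented by the span of its two legs \<open>(r1, r2)\<close>. Products, pullbacks,
  composites and images are determined only up to isomorphism, so they are treated as predicates
  holding of every possible choice rather than as functions.\<close>

definition is_relation :: "('o, 'a) cat \<Rightarrow> 'o \<Rightarrow> 'o \<Rightarrow> 'a \<times> 'a \<Rightarrow> bool" where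
  "is_relation C X Y r \<longleftrightarrow>
     (\<exists>q1 q2 m. is_product C X Y q1 q2 \<and> mono_arr C m \<and> Cod C m = Dom C q1 \<and>
        r = (q1 \<cdot>\<^bsub>C\<^esub> m, q2 \<cdot>\<^bsub>C\<^esub> m))"

text \<open>Equality of relations as subobjects.\<close>

definition same_relation :: "('o, 'a) cat \<Rightarrow> 'a \<times> 'a \<Rightarrow> 'a \<times> 'a \<Rightarrow> bool" where
  "same_relation C r s \<longleftrightarrow>
     (\<exists>i. iso_arr C i \<and> i \<in> hom C (Dom C (fst r)) (Dom C (fst s)) \<and>
        fst s \<cdot>\<^bsub>C\<^esub> i = fst r \<and> snd s \<cdot>\<^bsub>C\<^esub> i = snd r)"

text \<open>\<open>is_composite C r s t\<close> says that \<open>t\<close> is the composite written \<open>S R\<close>, i.e. first \<open>r\<close>,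
  then \<open>s\<close>.\<close>

definition is_composite :: "('o, 'a) cat \<Rightarrow> 'a \<times> 'a \<Rightarrow> 'a \<times> 'a \<Rightarrow> 'a \<times> 'a \<Rightarrow> bool" where
  "is_composite C r s t \<longleftrightarrow>
     (\<exists>p1 p2 q1 q2 h m.
        is_pullback C (snd r) (fst s) p1 p2 \<and>
        is_product C (Cod C (fst r)) (Cod C (snd s)) q1 q2 \<and>
        h \<in> hom C (Dom C p1) (Dom C q1) \<and>
        q1 \<cdot>\<^bsub>C\<^esub> h = fst r \<cdot>\<^bsub>C\<^esub> p1 \<and> q2 \<cdot>\<^bsub>C\<^esub> h = snd s \<cdot>\<^bsub>C\<^esub> p2 \<and>
        is_image C h m \<and>
        t = (q1 \<cdot>\<^bsub>C\<^esub> m, q2 \<cdot>\<^bsub>C\<^esub> m))"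

definition reflexive_relation :: "('o, 'a) cat \<Rightarrow> 'o \<Rightarrow> 'a \<times> 'a \<Rightarrow> bool" where
  "reflexive_relation C X r \<longleftrightarrow>
     (\<exists>d\<in>hom C X (Dom C (fst r)). fst r \<cdot>\<^bsub>C\<^esub> d = Idt C X \<and> snd r \<cdot>\<^bsub>C\<^esub> d = Idt C X)"

definition symmetric_relation :: "('o, 'a) cat \<Rightarrow> 'a \<times> 'a \<Rightarrow> bool" where
  "symmetric_relation C r \<longleftrightarrow>
     (\<exists>k\<in>hom C (Dom C (fst r)) (Dom C (fst r)).
        fst r \<cdot>\<^bsub>C\<^esub> k = snd r \<and> snd r \<cdot>\<^bsub>C\<^esub> k = fst r)"

definition transitive_relation :: "('o, 'a) cat \<Rightarrow> 'a \<times> 'a \<Rightarrow> bool" where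
  "transitive_relation C r \<longleftrightarrow>
     (\<forall>p1 p2. is_pullback C (snd r) (fst r) p1 p2 \<longrightarrow>
        (\<exists>t\<in>hom C (Dom C p1) (Dom C (fst r)).
           fst r \<cdot>\<^bsub>C\<^esub> t = fst r \<cdot>\<^bsub>C\<^esub> p1 \<and> snd r \<cdot>\<^bsub>C\<^esub> t = snd r \<cdot>\<^bsub>C\<^esub> p2))"

definition equivalence_relation :: "('o, 'a) cat \<Rightarrow> 'o \<Rightarrow> 'a \<times> 'a \<Rightarrow> bool" where
  "equivalence_relation C X r \<longleftrightarrow>
     is_relation C X X r \<and> reflexive_relation C X r \<and>
     symmetric_relation C r \<and> transitive_relation C r"

text \<open>Below \<open>sr\<close>, \<open>rsr\<close>, \<open>rs\<close>, \<open>srs\<close> are the composites \<open>S R\<close>, \<open>R (S R)\<close>, \<open>R S\<close>, \<open>S (R S)\<close>.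
  The bracketing is immaterial, composition of relations being associative in a regular
  category.\<close>

locale goursat_category = regular_category C for C :: "('o, 'a) cat" (structure) +
  assumes goursat:
    "\<lbrakk>equivalence_relation C X r; equivalence_relation C X s;
      is_composite C r s sr; is_composite C sr r rsr;
      is_composite C s r rs; is_composite C rs s srs\<rbrakk>
     \<Longrightarrow> same_relation C rsr srs"

text \<open>\<open>t\<close> is the regular image of the relation \<open>r\<close> on the domain of \<open>f\<close>: \<open>g\<close> is the pairing
  \<open>\<langle>r1, r2\<rangle>\<close> and \<open>ff\<close> is \<open>f \<times> f\<close>.\<close>

definition is_regular_image :: "('o, 'a) cat \<Rightarrow> 'a \<Rightarrow> 'a \<times> 'a \<Rightarrow> 'a \<times> 'a \<Rightarrow> bool" where
  "is_regular_image C f r t \<longleftrightarrow>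
     (\<exists>p1 p2 q1 q2 g ff m.
        is_product C (Dom C f) (Dom C f) p1 p2 \<and>
        is_product C (Cod C f) (Cod C f) q1 q2 \<and>
        g \<in> hom C (Dom C (fst r)) (Dom C p1) \<and>
        p1 \<cdot>\<^bsub>C\<^esub> g = fst r \<and> p2 \<cdot>\<^bsub>C\<^esub> g = snd r \<and>
        ff \<in> hom C (Dom C p1) (Dom C q1) \<and>
        q1 \<cdot>\<^bsub>C\<^esub> ff = f \<cdot>\<^bsub>C\<^esub> p1 \<and> q2 \<cdot>\<^bsub>C\<^esub> ff = f \<cdot>\<^bsub>C\<^esub> p2 \<and>
        is_image C (ff \<cdot>\<^bsub>C\<^esub> g) m \<and>
        t = (q1 \<cdot>\<^bsub>C\<^esub> m, q2 \<cdot>\<^bsub>C\<^esub> m))"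


section \<open>Connectors\<close>

text \<open>For generalized elements \<open>x\<close>, \<open>y\<close> (arrows with a common domain), \<open>related C r x y\<close> is
  \<open>x R y\<close>: the pair factors through the relation.\<close>

definition related :: "('o, 'a) cat \<Rightarrow> 'a \<times> 'a \<Rightarrow> 'a \<Rightarrow> 'a \<Rightarrow> bool" where
  "related C r x y \<longleftrightarrow>
     (\<exists>h\<in>Ar C. Cod C h = Dom C (fst r) \<and> fst r \<cdot>\<^bsub>C\<^esub> h = x \<and> snd r \<cdot>\<^bsub>C\<^esub> h = y)"

text \<open>\<open>conn_val C r s a b p x y z w\<close> says that the partial term \<open>p(x,y,z)\<close> is defined and equals
  \<open>w\<close>. Here \<open>a\<close>, \<open>b\<close> are the projections of the pullback of \<open>r2\<close> along \<open>s1\<close>, and \<open>t\<close> is the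
  generalized element \<open>(x,y,z)\<close> of that pullback, which exists exactly when \<open>x R y\<close> and
  \<open>y S z\<close>, and is then unique.\<close>

definition conn_val :: "('o, 'a) cat \<Rightarrow> 'a \<times> 'a \<Rightarrow> 'a \<times> 'a \<Rightarrow> 'a \<Rightarrow> 'a \<Rightarrow> 'a
    \<Rightarrow> 'a \<Rightarrow> 'a \<Rightarrow> 'a \<Rightarrow> 'a \<Rightarrow> bool" where
  "conn_val C r s a b p x y z w \<longleftrightarrow>
     (\<exists>t\<in>Ar C. Cod C t = Dom C a \<and>
        fst r \<cdot>\<^bsub>C\<^esub> (a \<cdot>\<^bsub>C\<^esub> t) = x \<and>
        snd r \<cdot>\<^bsub>C\<^esub> (a \<cdot>\<^bsub>C\<^esub> t) = y \<and>
        fst s \<cdot>\<^bsub>C\<^esub> (b \<cdot>\<^bsub>C\<^esub> t) = y \<and>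
        snd s \<cdot>\<^bsub>C\<^esub> (b \<cdot>\<^bsub>C\<^esub> t) = z \<and>
        p \<cdot>\<^bsub>C\<^esub> t = w)"

definition is_connector :: "('o, 'a) cat \<Rightarrow> 'o \<Rightarrow> 'a \<times> 'a \<Rightarrow> 'a \<times> 'a
    \<Rightarrow> 'a \<Rightarrow> 'a \<Rightarrow> 'a \<Rightarrow> bool" where
  "is_connector C X r s a b p \<longleftrightarrow>
     equivalence_relation C X r \<and> equivalence_relation C X s \<and>
     is_pullback C (snd r) (fst s) a b \<and>
     p \<in> hom C (Dom C a) X \<and>
     (\<forall>x y z w. conn_val C r s a b p x y z w \<longrightarrow> related C s x w \<and> related C r w z) \<and>
     (\<forall>x y w. conn_val C r s a b p x x y w \<longrightarrow> w = y) \<and>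
     (\<forall>x y w. conn_val C r s a b p x y y w \<longrightarrow> w = x) \<and>
     (\<forall>x y z u v k l m n.
        conn_val C r s a b p z u v k \<and> conn_val C r s a b p x y k l \<and>
        conn_val C r s a b p x y z m \<and> conn_val C r s a b p m u v n \<longrightarrow> l = n)"

definition has_connector :: "('o, 'a) cat \<Rightarrow> 'o \<Rightarrow> 'a \<times> 'a \<Rightarrow> 'a \<times> 'a \<Rightarrow> bool" where
  "has_connector C X r s \<longleftrightarrow> (\<exists>a b p. is_connector C X r s a b p)"

end

theory Submission imports Defs begin

text \<open>
  Arguments are carried out with generalized elements, up to covers by regular epimorphisms. The
  Goursat condition then says that \<open>x R y S z R w\<close> implies \<open>x S u R v S w\<close> on a cover. It is used
  for kernel pairs, and for a relation and the kernel pair of \<open>f\<close> to see that images of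
  equivalence relations are equivalence relations.

  Let \<open>P\<close> and \<open>P'\<close> be the objects of triples \<open>x R y S z\<close> over \<open>X\<close> and over \<open>Y\<close>. The comparison
  \<open>P \<rightarrow> P'\<close> is a regular epimorphism because pullbacks of split epimorphisms preserve covers in a
  Goursat category: if \<open>a\<close> in \<open>A\<close> and \<open>d\<close> in \<open>D\<close> have images that agree only after applying the
  cover of \<open>B\<close>, let \<open>b\<close> and \<open>b'\<close> be their images in \<open>B\<close>, let \<open>t\<close> and \<open>s\<close> be the
  splittings with values in \<open>A\<close> and \<open>D\<close>, and apply the Goursat condition to the
  chain \<open>(a, s b), (t b, s b), (t b', s b'), (t b', d)\<close> in the pullback of \<open>A\<close> and \<open>D\<close> over \<open>B\<close>.
  The composite of \<open>p\<close> with \<open>f\<close> factors through the comparison by the shifting property of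
  kernel pairs, and the axioms for the induced arrow follow by lifting triples along the
  comparison. For associativity one lifts a chain \<open>x R y S z R u S v\<close>, and this is the same
  pullback property for the first and third projections \<open>P \<rightarrow> X\<close>, split by the diagonal.
\<close>

section \<open>Finite limits and regular epimorphisms\<close>

lemma ex1_eqI: "\<lbrakk>\<exists>!x. P x; P a; P b\<rbrakk> \<Longrightarrow> a = b"
  by blast

section \<open>Elementary calculus of arrows, limits and coequalizers\<close>

context category
begin

lemma hom_iff: "f \<in> hom C X Y \<longleftrightarrow> f \<in> Ar C \<and> Dom C f = X \<and> Cod C f = Y"
  by (auto simp: hom_def)

lemma Cmp_in_hom: "\<lbrakk>f \<in> Ar C; g \<in> Ar C; Cod C f = Dom C g\<rbrakk> \<Longrightarrow> g \<cdot> f \<in> hom C (Dom C f) (Cod C g)"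
  by (rule Cmp_hom[of _ _ "Dom C g"]) (auto simp: hom_def)

lemma Cmp_Ar [simp]: "\<lbrakk>f \<in> Ar C; g \<in> Ar C; Cod C f = Dom C g\<rbrakk> \<Longrightarrow> g \<cdot> f \<in> Ar C"
  and Dom_Cmp [simp]: "\<lbrakk>f \<in> Ar C; g \<in> Ar C; Cod C f = Dom C g\<rbrakk> \<Longrightarrow> Dom C (g \<cdot> f) = Dom C f"
  and Cod_Cmp [simp]: "\<lbrakk>f \<in> Ar C; g \<in> Ar C; Cod C f = Dom C g\<rbrakk> \<Longrightarrow> Cod C (g \<cdot> f) = Cod C g"
  using Cmp_in_hom by (auto simp: hom_def)

lemma Idt_Ar [simp]: "X \<in> Ob C \<Longrightarrow> Idt C X \<in> Ar C"
  and Dom_Idt [simp]: "X \<in> Ob C \<Longrightarrow> Dom C (Idt C X) = X"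
  and Cod_Idt [simp]: "X \<in> Ob C \<Longrightarrow> Cod C (Idt C X) = X"
  using Idt_hom by (auto simp: hom_def)

lemma Ob_Dom [simp]: "f \<in> Ar C \<Longrightarrow> Dom C f \<in> Ob C"
  and Ob_Cod [simp]: "f \<in> Ar C \<Longrightarrow> Cod C f \<in> Ob C"
  by (simp_all add: Dom_Ob Cod_Ob)

lemma Cmp_Idt_right [simp]: "\<lbrakk>f \<in> Ar C; Dom C f = X\<rbrakk> \<Longrightarrow> f \<cdot> Idt C X = f"
  and Cmp_Idt_left [simp]: "\<lbrakk>f \<in> Ar C; Cod C f = X\<rbrakk> \<Longrightarrow> Idt C X \<cdot> f = f"
  using Cmp_Idt[of f] Idt_Cmp[of f] by (auto simp: hom_def)

lemma assoc: "\<lbrakk>f \<in> Ar C; g \<in> Ar C; h \<in> Ar C; Cod C f = Dom C g; Cod C g = Dom C h\<rbrakk>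
    \<Longrightarrow> (h \<cdot> g) \<cdot> f = h \<cdot> (g \<cdot> f)"
  by (rule Cmp_assoc) (auto simp: hom_def)

text \<open>Rewriting with \<open>assoc\<close> brackets composites to the right, so a known
  equation for \<open>g \<cdot> f\<close> no longer matches inside a longer chain. This form applies
  it there.\<close>

lemma Cmp_extend:
  "\<lbrakk>g \<cdot> f = k; f \<in> Ar C; g \<in> Ar C; Cod C f = Dom C g; t \<in> Ar C; Cod C t = Dom C f\<rbrakk>
    \<Longrightarrow> g \<cdot> (f \<cdot> t) = k \<cdot> t"
  using assoc by metis

lemma pullback_ex1:
  assumes "is_pullback C f g p1 p2" "a \<in> hom C T (Dom C f)" "b \<in> hom C T (Dom C g)" "f \<cdot> a = g \<cdot> b"
  shows "\<exists>!h. h \<in> hom C T (Dom C p1) \<and> p1 \<cdot> h = a \<and> p2 \<cdot> h = b"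
  using assms(1) unfolding is_pullback_def
  by (elim conjE allE[of _ T]) (drule bspec[OF _ assms(2)], drule bspec[OF _ assms(3)], erule mp, rule assms(4))

lemma product_ex1:
  assumes "is_product C X Y q1 q2" "a \<in> hom C T X" "b \<in> hom C T Y"
  shows "\<exists>!h. h \<in> hom C T (Dom C q1) \<and> q1 \<cdot> h = a \<and> q2 \<cdot> h = b"
  using assms(1) unfolding is_product_def
  by (elim conjE allE[of _ T]) (drule bspec[OF _ assms(2)], drule bspec[OF _ assms(3)], assumption)

lemma coequalizer_ex1:
  assumes "is_coequalizer C u v e" "a \<in> hom C (Cod C u) T" "a \<cdot> u = a \<cdot> v"
  shows "\<exists>!h. h \<in> hom C (Cod C e) T \<and> h \<cdot> e = a"
  using assms(1) unfolding is_coequalizer_def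
  by (elim conjE allE[of _ T]) (drule bspec[OF _ assms(2)], erule mp, rule assms(3))

lemma pullbackD:
  assumes "is_pullback C f g p1 p2"
  shows "f \<in> Ar C" "g \<in> Ar C" "Cod C g = Cod C f" "p1 \<in> Ar C" "p2 \<in> Ar C"
    "Cod C p1 = Dom C f" "Cod C p2 = Dom C g" "Dom C p2 = Dom C p1" "f \<cdot> p1 = g \<cdot> p2"
  using assms by (auto simp: is_pullback_def hom_def)

lemma pullback_lift:
  assumes "is_pullback C f g p1 p2" "a \<in> Ar C" "b \<in> Ar C" "Dom C b = Dom C a"
    "Cod C a = Dom C f" "Cod C b = Dom C g" "f \<cdot> a = g \<cdot> b"
  obtains h where "h \<in> Ar C" "Dom C h = Dom C a" "Cod C h = Dom C p1" "p1 \<cdot> h = a" "p2 \<cdot> h = b"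
proof -
  have "a \<in> hom C (Dom C a) (Dom C f)" "b \<in> hom C (Dom C a) (Dom C g)"
    using assms by (auto simp: hom_def)
  from ex1_implies_ex[OF pullback_ex1[OF assms(1) this assms(7)]]
  obtain h where "h \<in> hom C (Dom C a) (Dom C p1)" "p1 \<cdot> h = a" "p2 \<cdot> h = b"
    by blast
  then show ?thesis by (intro that[of h]) (auto simp: hom_def)
qed

lemma pullback_unique:
  assumes pb: "is_pullback C f g p1 p2" and h: "h \<in> Ar C" "Cod C h = Dom C p1"
    and k: "k \<in> Ar C" "Cod C k = Dom C p1" "Dom C k = Dom C h"
    and eq: "p1 \<cdot> h = p1 \<cdot> k" "p2 \<cdot> h = p2 \<cdot> k"
  shows "h = k"
proof -
  note [simp] = pullbackD[OF pb] h k
  have "p1 \<cdot> h \<in> hom C (Dom C h) (Dom C f)" "p2 \<cdot> h \<in> hom C (Dom C h) (Dom C g)"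
    by (auto simp: hom_def)
  moreover have "f \<cdot> (p1 \<cdot> h) = g \<cdot> (p2 \<cdot> h)"
    using assoc[of h p1 f] assoc[of h p2 g] by simp
  ultimately have "\<exists>!l. l \<in> hom C (Dom C h) (Dom C p1) \<and> p1 \<cdot> l = p1 \<cdot> h \<and> p2 \<cdot> l = p2 \<cdot> h"
    by (rule pullback_ex1[OF pb])
  then show ?thesis by (rule ex1_eqI) (use eq in \<open>auto simp: hom_def\<close>)
qed

lemma pullback_commutes:
  assumes pb: "is_pullback C f g p1 p2" and h: "h \<in> Ar C" "Cod C h = Dom C p1"
  shows "f \<cdot> (p1 \<cdot> h) = g \<cdot> (p2 \<cdot> h)"
proof -
  note [simp] = pullbackD[OF pb] h
  show ?thesis using assoc[of h p1 f] assoc[of h p2 g] by simp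
qed

lemma productD:
  assumes "is_product C X Y q1 q2"
  shows "q1 \<in> Ar C" "q2 \<in> Ar C" "Cod C q1 = X" "Cod C q2 = Y" "Dom C q2 = Dom C q1"
  using assms by (auto simp: is_product_def hom_def)

lemma product_lift:
  assumes "is_product C X Y q1 q2" "a \<in> Ar C" "b \<in> Ar C" "Dom C b = Dom C a"
    "Cod C a = X" "Cod C b = Y"
  obtains h where "h \<in> Ar C" "Dom C h = Dom C a" "Cod C h = Dom C q1" "q1 \<cdot> h = a" "q2 \<cdot> h = b"
proof -
  have "a \<in> hom C (Dom C a) X" "b \<in> hom C (Dom C a) Y"
    using assms by (auto simp: hom_def)
  from ex1_implies_ex[OF product_ex1[OF assms(1) this]]
  obtain h where "h \<in> hom C (Dom C a) (Dom C q1)" "q1 \<cdot> h = a" "q2 \<cdot> h = b"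
    by blast
  then show ?thesis by (intro that[of h]) (auto simp: hom_def)
qed

lemma product_unique:
  assumes pr: "is_product C X Y q1 q2" and h: "h \<in> Ar C" "Cod C h = Dom C q1"
    and k: "k \<in> Ar C" "Cod C k = Dom C q1" "Dom C k = Dom C h"
    and eq: "q1 \<cdot> h = q1 \<cdot> k" "q2 \<cdot> h = q2 \<cdot> k"
  shows "h = k"
proof -
  note [simp] = productD[OF pr] h k
  have "q1 \<cdot> h \<in> hom C (Dom C h) X" "q2 \<cdot> h \<in> hom C (Dom C h) Y"
    by (auto simp: hom_def)
  then have "\<exists>!l. l \<in> hom C (Dom C h) (Dom C q1) \<and> q1 \<cdot> l = q1 \<cdot> h \<and> q2 \<cdot> l = q2 \<cdot> h"
    by (rule product_ex1[OF pr])
  then show ?thesis by (rule ex1_eqI) (use eq in \<open>auto simp: hom_def\<close>)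
qed

lemma monoD:
  assumes "mono_arr C m" "a \<in> Ar C" "b \<in> Ar C" "Cod C a = Dom C m" "Cod C b = Dom C m"
    "Dom C b = Dom C a" "m \<cdot> a = m \<cdot> b"
  shows "a = b"
proof -
  have "a \<in> hom C (Dom C a) (Dom C m)" "b \<in> hom C (Dom C a) (Dom C m)"
    using assms(2-6) by (simp_all add: hom_def)
  with assms(1) show ?thesis
    unfolding mono_arr_def using assms(7) by (elim conjE) (drule spec, drule (1) bspec, drule (1) bspec, erule (1) mp)
qed

lemma mono_Ar: "mono_arr C m \<Longrightarrow> m \<in> Ar C"
  by (simp add: mono_arr_def)

lemma monoI:
  assumes "m \<in> Ar C"
    and "\<And>a b. \<lbrakk>a \<in> Ar C; b \<in> Ar C; Cod C a = Dom C m; Cod C b = Dom C m; Dom C b = Dom C a;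
          m \<cdot> a = m \<cdot> b\<rbrakk> \<Longrightarrow> a = b"
  shows "mono_arr C m"
  unfolding mono_arr_def
proof (intro conjI allI ballI impI)
  fix T a b assume "a \<in> hom C T (Dom C m)" "b \<in> hom C T (Dom C m)" "m \<cdot> a = m \<cdot> b"
  then show "a = b" by - (rule assms(2), simp_all add: hom_def)
qed (rule assms(1))

lemma coequalizerD:
  assumes "is_coequalizer C u v e"
  shows "u \<in> Ar C" "v \<in> Ar C" "e \<in> Ar C" "Dom C v = Dom C u" "Cod C v = Cod C u"
    "Dom C e = Cod C u" "e \<cdot> u = e \<cdot> v"
  using assms by (auto simp: is_coequalizer_def hom_def)

lemma coequalizer_factor:
  assumes "is_coequalizer C u v e" "a \<in> Ar C" "Dom C a = Cod C u" "a \<cdot> u = a \<cdot> v"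
  obtains h where "h \<in> Ar C" "Dom C h = Cod C e" "Cod C h = Cod C a" "h \<cdot> e = a"
proof -
  have "a \<in> hom C (Cod C u) (Cod C a)" using assms by (auto simp: hom_def)
  from ex1_implies_ex[OF coequalizer_ex1[OF assms(1) this assms(4)]]
  obtain h where "h \<in> hom C (Cod C e) (Cod C a)" "h \<cdot> e = a"
    by blast
  then show ?thesis by (intro that[of h]) (auto simp: hom_def)
qed

lemma regular_epi_Ar: "regular_epi C e \<Longrightarrow> e \<in> Ar C"
  by (auto simp: regular_epi_def dest: coequalizerD)

text \<open>Both arrows are factorisations of the same composite through a coequalizer, and such a
  factorisation is unique.\<close>

lemma regular_epi_cancel:
  assumes e: "regular_epi C e" and h: "h \<in> Ar C" "Dom C h = Cod C e"
    and k: "k \<in> Ar C" "Dom C k = Cod C e" and eq: "h \<cdot> e = k \<cdot> e"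
  shows "h = k"
proof -
  obtain u v where uv: "is_coequalizer C u v e" using e by (auto simp: regular_epi_def)
  note [simp] = coequalizerD[OF uv] h k
  \<comment> \<open>The codomains are not assumed equal, but the equation of composites forces it;
    uniqueness of factorisations needs a common target.\<close>
  have cod: "Cod C k = Cod C h"
    using Cod_Cmp[of e h] Cod_Cmp[of e k] eq by simp
  have "(h \<cdot> e) \<cdot> u = (h \<cdot> e) \<cdot> v" by (simp add: assoc)
  moreover have "h \<cdot> e \<in> hom C (Cod C u) (Cod C h)" by (simp add: hom_def)
  ultimately have "\<exists>!l. l \<in> hom C (Cod C e) (Cod C h) \<and> l \<cdot> e = h \<cdot> e"
    by (rule coequalizer_ex1[OF uv, rotated])
  then show ?thesis by (rule ex1_eqI) (use eq cod in \<open>auto simp: hom_def\<close>)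
qed

text \<open>The pair coequalized by \<open>e\<close> is one of the pairs that \<open>e\<close>
  identifies. Quantifying over all such pairs frees later arguments from any chosen pair.\<close>

lemma regular_epi_factor:
  assumes e: "regular_epi C e" and a: "a \<in> Ar C" "Dom C a = Dom C e"
    and eq: "\<And>u v. \<lbrakk>u \<in> Ar C; v \<in> Ar C; Cod C u = Dom C e; Cod C v = Dom C e; Dom C v = Dom C u;
        e \<cdot> u = e \<cdot> v\<rbrakk> \<Longrightarrow> a \<cdot> u = a \<cdot> v"
  obtains h where "h \<in> Ar C" "Dom C h = Cod C e" "Cod C h = Cod C a" "h \<cdot> e = a"
proof -
  obtain u v where uv: "is_coequalizer C u v e" using e by (auto simp: regular_epi_def)
  note D = coequalizerD[OF uv]
  have "a \<cdot> u = a \<cdot> v" by (rule eq) (use D in simp_all)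
  then show ?thesis
    using coequalizer_factor[OF uv a(1)] a(2) D(6) that by metis
qed

text \<open>The composite is a coequalizer of the same pair as \<open>e\<close>: factorisations are
  transported along the inverse of \<open>i\<close>.\<close>

lemma iso_Cmp_regular_epi:
  assumes i: "iso_arr C i" and e: "regular_epi C e" and ie: "Cod C e = Dom C i"
  shows "regular_epi C (i \<cdot> e)"
proof -
  obtain u v where uv: "is_coequalizer C u v e" using e by (auto simp: regular_epi_def)
  obtain j where j: "j \<in> Ar C" "Dom C j = Cod C i" "Cod C j = Dom C i"
      "j \<cdot> i = Idt C (Dom C i)" "i \<cdot> j = Idt C (Cod C i)" and iA: "i \<in> Ar C"
    using i by (auto simp: iso_arr_def hom_def)
  note [simp] = coequalizerD[OF uv] j ie iA
  have "is_coequalizer C u v (i \<cdot> e)"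
    unfolding is_coequalizer_def
  proof (intro conjI allI ballI impI)
    fix T a assume a: "a \<in> hom C (Cod C u) T" "a \<cdot> u = a \<cdot> v"
    then obtain h where h: "h \<in> Ar C" "Dom C h = Cod C e" "Cod C h = T" "h \<cdot> e = a"
      using coequalizer_factor[OF uv, of a] by (auto simp: hom_def)
    note [simp] = h
    show "\<exists>!h. h \<in> hom C (Cod C (i \<cdot> e)) T \<and> h \<cdot> (i \<cdot> e) = a"
    proof (rule ex1I[of _ "h \<cdot> j"])
      have "j \<cdot> (i \<cdot> e) = e" using Cmp_extend[OF j(4), of e] by simp
      then have "(h \<cdot> j) \<cdot> (i \<cdot> e) = a" by (simp add: assoc)
      then show "h \<cdot> j \<in> hom C (Cod C (i \<cdot> e)) T \<and> (h \<cdot> j) \<cdot> (i \<cdot> e) = a"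
        by (simp add: hom_def)
    next
      fix l assume l: "l \<in> hom C (Cod C (i \<cdot> e)) T \<and> l \<cdot> (i \<cdot> e) = a"
      then have [simp]: "l \<in> Ar C" "Dom C l = Cod C i" by (auto simp: hom_def)
      have "(l \<cdot> i) \<cdot> e = h \<cdot> e" using l by (simp add: assoc)
      then have "l \<cdot> i = h" by - (rule regular_epi_cancel[OF e], auto)
      then have "h \<cdot> j = l \<cdot> (i \<cdot> j)" using assoc[of j i l] by simp
      then show "l = h \<cdot> j" by simp
    qed
  qed (auto simp: hom_def assoc)
  then show ?thesis by (auto simp: regular_epi_def)
qed

end

section \<open>Binary products and pullbacks as finite limits\<close>

text \<open>Each identity carries the number of its object. An arrow is composable only with itself,
  so returning either argument is a correct composition.\<close>

definition discrete_pair :: "(nat, nat) cat" where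
  "discrete_pair = \<lparr>Ob = {0, 1}, Ar = {0, 1}, Dom = (\<lambda>a. a), Cod = (\<lambda>a. a), Idt = (\<lambda>a. a),
     Cmp = (\<lambda>b a. a)\<rparr>"

text \<open>The arrows 3 and 4 go from 0 and 1, respectively, to 2.\<close>

definition cospan_shape :: "(nat, nat) cat" where
  "cospan_shape = \<lparr>Ob = {0, 1, 2}, Ar = {0, 1, 2, 3, 4},
     Dom = (\<lambda>a. if a = 3 then 0 else if a = 4 then 1 else a),
     Cod = (\<lambda>a. if 3 \<le> a then 2 else a), Idt = (\<lambda>a. a),
     Cmp = (\<lambda>b a. if 3 \<le> a then a else b)\<rparr>"

lemma category_discrete_pair: "category discrete_pair"
  by unfold_locales (auto simp: discrete_pair_def hom_def)

lemma category_cospan_shape: "category cospan_shape"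
  by unfold_locales (auto simp: cospan_shape_def hom_def split: if_splits)

context regular_category
begin

lemma product_exists:
  assumes X: "X \<in> Ob C" and Y: "Y \<in> Ob C"
  obtains q1 q2 where "is_product C X Y q1 q2"
proof -
  let ?Fo = "\<lambda>i. if i = 0 then X else Y"
  have "is_functor discrete_pair C ?Fo (\<lambda>i. Idt C (?Fo i))"
    using X Y by (auto simp: is_functor_def discrete_pair_def hom_def)
  moreover have "finite (Ob discrete_pair)" "finite (Ar discrete_pair)"
    by (auto simp: discrete_pair_def)
  ultimately obtain L c where L: "is_limit discrete_pair C ?Fo (\<lambda>i. Idt C (?Fo i)) L c"
    using finitely_complete category_discrete_pair unfolding finitely_complete_def by blast
  then have c: "c 0 \<in> hom C L X" "c 1 \<in> hom C L Y" and LO: "L \<in> Ob C"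
    by (auto simp: is_limit_def is_cone_def discrete_pair_def)
  then have D: "Dom C (c 0) = L" by (simp add: hom_def)
  have "is_product C X Y (c 0) (c 1)"
    unfolding is_product_def D
  proof (intro conjI allI ballI)
    fix T a b assume a: "a \<in> hom C T X" and b: "b \<in> hom C T Y"
    let ?d = "\<lambda>i. if i = (0::nat) then a else b"
    have "is_cone discrete_pair C ?Fo (\<lambda>i. Idt C (?Fo i)) T ?d"
      using a b Ob_Dom[of a] by (auto simp: is_cone_def discrete_pair_def hom_def)
    with L have "\<exists>!h. h \<in> hom C T L \<and> (\<forall>i\<in>Ob discrete_pair. c i \<cdot> h = ?d i)"
      unfolding is_limit_def by blast
    then show "\<exists>!h. h \<in> hom C T L \<and> c 0 \<cdot> h = a \<and> c 1 \<cdot> h = b"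
      by (simp add: discrete_pair_def)
  qed (use c in auto)
  with that show thesis .
qed

lemma pullback_exists:
  assumes f: "f \<in> Ar C" and g: "g \<in> Ar C" and fg: "Cod C g = Cod C f"
  obtains p1 p2 where "is_pullback C f g p1 p2"
proof -
  let ?Fo = "\<lambda>i. if i = 0 then Dom C f else if i = 1 then Dom C g else Cod C f"
  let ?Fa = "\<lambda>i. if i = 3 then f else if i = 4 then g else Idt C (?Fo i)"
  have "is_functor cospan_shape C ?Fo ?Fa"
    using f g fg by (auto simp: is_functor_def cospan_shape_def hom_def)
  moreover have "finite (Ob cospan_shape)" "finite (Ar cospan_shape)"
    by (auto simp: cospan_shape_def)
  ultimately obtain L c where L: "is_limit cospan_shape C ?Fo ?Fa L c"
    using finitely_complete category_cospan_shape unfolding finitely_complete_def by blast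
  then have c: "c 0 \<in> hom C L (Dom C f)" "c 1 \<in> hom C L (Dom C g)" and LO: "L \<in> Ob C"
    and e: "f \<cdot> c 0 = c 2" "g \<cdot> c 1 = c 2"
    by (auto simp: is_limit_def is_cone_def cospan_shape_def)
  then have D: "Dom C (c 0) = L" by (simp add: hom_def)
  have "is_pullback C f g (c 0) (c 1)"
    unfolding is_pullback_def D
  proof (intro conjI allI ballI impI)
    fix T a b assume a: "a \<in> hom C T (Dom C f)" and b: "b \<in> hom C T (Dom C g)"
      and ab: "f \<cdot> a = g \<cdot> b"
    let ?d = "\<lambda>i. if i = (0::nat) then a else if i = 1 then b else f \<cdot> a"
    have "is_cone cospan_shape C ?Fo ?Fa T ?d"
      using a b ab f g fg Ob_Dom[of a] by (auto simp: is_cone_def cospan_shape_def hom_def)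
    with L have "\<exists>!h. h \<in> hom C T L \<and> (\<forall>i\<in>Ob cospan_shape. c i \<cdot> h = ?d i)"
      unfolding is_limit_def by blast
    \<comment> \<open>The component at the vertex \<open>2\<close> is forced by the one at
      \<open>0\<close>, so uniqueness for cones becomes uniqueness for the two legs alone.\<close>
    moreover have "c 2 \<cdot> h = f \<cdot> a" if "h \<in> hom C T L" "c 0 \<cdot> h = a" for h
      using Cmp_extend[OF e(1), of h] that c f by (auto simp: hom_def)
    ultimately show "\<exists>!h. h \<in> hom C T L \<and> c 0 \<cdot> h = a \<and> c 1 \<cdot> h = b"
      by (simp add: cospan_shape_def) metis
  qed (use f g fg c e in auto)
  with that show thesis .
qed

section \<open>Regular epimorphisms as covers, and image factorisations\<close>

text \<open>Pull back \<open>e\<close> along \<open>x\<close>: by stability the projection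
  \<open>c\<close> is a cover. This replaces choosing a preimage of a generalized element, at the
  price of a change of domain.\<close>

lemma regular_epi_lift:
  assumes e: "regular_epi C e" and x: "x \<in> Ar C" "Cod C x = Cod C e"
  obtains c y where "regular_epi C c" "Cod C c = Dom C x" "y \<in> Ar C" "Dom C y = Dom C c"
    "Cod C y = Dom C e" "e \<cdot> y = x \<cdot> c"
proof -
  obtain c y where pb: "is_pullback C x e c y"
    using pullback_exists[OF x(1) regular_epi_Ar[OF e]] x(2) by metis
  with regular_epi_stable[OF pb e] pullbackD[OF pb] that show ?thesis by metis
qed

text \<open>\<open>e\<close> is the coequalizer of the kernel pair of \<open>h\<close>. The induced
  \<open>m\<close> is mono because two elements with the same value under \<open>m\<close> lift, on
  a cover, to a pair in that kernel pair.\<close>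

lemma factorisation:
  assumes h: "h \<in> Ar C"
  obtains e m where "regular_epi C e" "mono_arr C m" "Cod C e = Dom C m" "h = m \<cdot> e"
    "Dom C e = Dom C h" "Cod C m = Cod C h"
proof -
  obtain u v where pb: "is_pullback C h h u v" using pullback_exists[OF h h] by metis
  then obtain e where ce: "is_coequalizer C u v e" using kernel_pair_coequalizer by blast
  have e: "regular_epi C e" using ce by (auto simp: regular_epi_def)
  have D: "u \<in> Ar C" "v \<in> Ar C" "Dom C v = Dom C u" "Cod C u = Dom C h" "Cod C v = Dom C h"
      "e \<in> Ar C" "Dom C e = Dom C h"
    using pullbackD(4-8)[OF pb] coequalizerD(3,6)[OF ce] by simp_all
  obtain m where m: "m \<in> Ar C" "Dom C m = Cod C e" "Cod C m = Cod C h" "m \<cdot> e = h"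
    using coequalizer_factor[OF ce h] pullbackD(6,9)[OF pb] by metis
  have "mono_arr C m"
  proof (rule monoI[OF m(1)])
    fix a b assume ab: "a \<in> Ar C" "b \<in> Ar C" "Cod C a = Dom C m" "Cod C b = Dom C m"
      "Dom C b = Dom C a" "m \<cdot> a = m \<cdot> b"
    \<comment> \<open>The two elements are lifted one after the other, \<open>a\<close> over
      \<open>c\<close> and then \<open>b\<close> over \<open>d\<close>, so that both lifts live on
      the domain of \<open>d\<close>.\<close>
    obtain c a' where c: "regular_epi C c" "Cod C c = Dom C a" "a' \<in> Ar C" "Dom C a' = Dom C c"
        "Cod C a' = Dom C e" "e \<cdot> a' = a \<cdot> c"
      using regular_epi_lift[OF e ab(1)] ab(3) m by metis
    have cA: "c \<in> Ar C" using c by (simp add: regular_epi_Ar)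
    have "b \<cdot> c \<in> Ar C" "Cod C (b \<cdot> c) = Cod C e" "Dom C (b \<cdot> c) = Dom C c"
      using ab m(2) c(2) cA by simp_all
    with regular_epi_lift[OF e] obtain d b' where d: "regular_epi C d" "Cod C d = Dom C c"
        "b' \<in> Ar C" "Dom C b' = Dom C d" "Cod C b' = Dom C e" "e \<cdot> b' = (b \<cdot> c) \<cdot> d"
      by metis
    have dA: "d \<in> Ar C" using d by (simp add: regular_epi_Ar)
    note [simp] = ab(1-5) m(1-3) c(2-5) d(2-5) cA dA D h
    have ead: "e \<cdot> (a' \<cdot> d) = a \<cdot> (c \<cdot> d)"
      using Cmp_extend[OF c(6), of d] by (simp add: assoc)
    have eb: "e \<cdot> b' = b \<cdot> (c \<cdot> d)"
      using d(6) by (simp add: assoc)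
    have mh: "m \<cdot> (e \<cdot> x) = h \<cdot> x" if "x \<in> Ar C" "Cod C x = Dom C h" for x
      using Cmp_extend[OF m(4), of x] that by simp
    have "h \<cdot> (a' \<cdot> d) = m \<cdot> (a \<cdot> (c \<cdot> d))"
      using mh[of "a' \<cdot> d"] by (simp add: ead)
    also have "\<dots> = m \<cdot> (b \<cdot> (c \<cdot> d))"
      using Cmp_extend[OF ab(6), of "c \<cdot> d"] by (simp add: assoc)
    also have "\<dots> = h \<cdot> b'"
      using mh[of b'] by (simp add: eb)
    finally have "h \<cdot> (a' \<cdot> d) = h \<cdot> b'" .
    moreover have "a' \<cdot> d \<in> Ar C" "Dom C b' = Dom C (a' \<cdot> d)" "Cod C (a' \<cdot> d) = Dom C h"
      by simp_all
    \<comment> \<open>The lifts agree under \<open>h\<close>, hence factor through its kernel pair,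
      which \<open>e\<close> coequalizes; \<open>a\<close> and \<open>b\<close> then agree after the
      covers \<open>d\<close> and \<open>c\<close>, which cancel.\<close>
    ultimately obtain k where k: "k \<in> Ar C" "Cod C k = Dom C u" "u \<cdot> k = a' \<cdot> d" "v \<cdot> k = b'"
      using pullback_lift[OF pb, of "a' \<cdot> d" b'] d(3,5) D(7) by metis
    have "e \<cdot> (u \<cdot> k) = e \<cdot> (v \<cdot> k)"
      using Cmp_extend[OF coequalizerD(7)[OF ce], of k] k(1,2) by (simp add: assoc)
    then have "(a \<cdot> c) \<cdot> d = (b \<cdot> c) \<cdot> d" by (simp add: k ead eb assoc)
    then have "a \<cdot> c = b \<cdot> c" by - (rule regular_epi_cancel[OF d(1)], auto)
    then show "a = b" by - (rule regular_epi_cancel[OF c(1)], auto)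
  qed
  then show thesis by (rule that[OF e, of m]) (simp_all add: m D)
qed

text \<open>Regular epimorphisms are extremal. As \<open>m\<close> is mono, \<open>k\<close>
  identifies whatever \<open>c\<close> does and so descends to \<open>l\<close>; this is a right
  inverse of \<open>m\<close>, and a mono with a right inverse is invertible.\<close>

lemma iso_if_regular_epi_factors:
  assumes c: "regular_epi C c" and m: "mono_arr C m"
    and k: "k \<in> Ar C" "Dom C k = Dom C c" "Cod C k = Dom C m" "m \<cdot> k = c"
  shows "iso_arr C m"
proof -
  note [simp] = regular_epi_Ar[OF c] mono_Ar[OF m] k(1-3)
  have [simp]: "Cod C m = Cod C c" using k(4) Cod_Cmp[of k m] by simp
  obtain l where l: "l \<in> Ar C" "Dom C l = Cod C c" "Cod C l = Dom C m" "l \<cdot> c = k"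
  proof (rule regular_epi_factor[OF c k(1)])
    fix u v assume uv [simp]: "u \<in> Ar C" "v \<in> Ar C" "Cod C u = Dom C c" "Cod C v = Dom C c"
      "Dom C v = Dom C u" and eq: "c \<cdot> u = c \<cdot> v"
    have "m \<cdot> (k \<cdot> u) = m \<cdot> (k \<cdot> v)"
      using Cmp_extend[OF k(4), of u] Cmp_extend[OF k(4), of v] eq by simp
    then show "k \<cdot> u = k \<cdot> v" by - (rule monoD[OF m], auto)
  qed auto
  note [simp] = l(1-3)
  have "(m \<cdot> l) \<cdot> c = Idt C (Cod C c) \<cdot> c" using l k by (simp add: assoc)
  then have ml: "m \<cdot> l = Idt C (Cod C c)" by - (rule regular_epi_cancel[OF c], auto)
  have "m \<cdot> (l \<cdot> m) = m \<cdot> Idt C (Dom C m)" using Cmp_extend[OF ml, of m] by simp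
  then have "l \<cdot> m = Idt C (Dom C m)" by - (rule monoD[OF m], auto)
  moreover have "l \<in> hom C (Cod C m) (Dom C m)" by (simp add: hom_def)
  ultimately show ?thesis unfolding iso_arr_def using ml by auto
qed

text \<open>Factor \<open>l = m \<cdot> e\<close>. The cover \<open>c\<close> factors through the
  mono \<open>m\<close>, which is therefore invertible, so \<open>l\<close> differs from
  \<open>e\<close> only by an isomorphism.\<close>

lemma regular_epi_if_covers:
  assumes l: "l \<in> Ar C" and c: "regular_epi C c" "Cod C c = Cod C l"
    and y: "y \<in> Ar C" "Dom C y = Dom C c" "Cod C y = Dom C l" "l \<cdot> y = c"
  shows "regular_epi C l"
proof -
  obtain e m where em: "regular_epi C e" "mono_arr C m" "Cod C e = Dom C m" "l = m \<cdot> e"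
      "Dom C e = Dom C l"
    using factorisation[OF l] by metis
  note [simp] = regular_epi_Ar[OF em(1)] mono_Ar[OF em(2)] em(3,5) y(1-3)
  have "m \<cdot> (e \<cdot> y) = c" using Cmp_extend[OF em(4)[symmetric], of y] y(4) by simp
  then have "iso_arr C m" by (intro iso_if_regular_epi_factors[OF c(1) em(2)]) auto
  then show ?thesis unfolding em(4) by (rule iso_Cmp_regular_epi[OF _ em(1,3)])
qed

text \<open>Factor the composite as \<open>m \<cdot> e\<close>. Since \<open>m\<close> is mono,
  \<open>e\<close> descends along \<open>f\<close> to some \<open>k\<close> with
  \<open>m \<cdot> k = g\<close>; the regular epimorphism \<open>g\<close> thus factors through
  \<open>m\<close>, which must be invertible.\<close>

lemma regular_epi_Cmp:
  assumes f: "regular_epi C f" and g: "regular_epi C g" and fg: "Cod C f = Dom C g"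
  shows "regular_epi C (g \<cdot> f)"
proof -
  note [simp] = regular_epi_Ar[OF f] regular_epi_Ar[OF g] fg
  have "g \<cdot> f \<in> Ar C" by simp
  then obtain e m where em: "regular_epi C e" "mono_arr C m" "Cod C e = Dom C m"
      "g \<cdot> f = m \<cdot> e" "Dom C e = Dom C f"
    using factorisation[of "g \<cdot> f"] Dom_Cmp[of f g] regular_epi_Ar[OF f] regular_epi_Ar[OF g] fg by metis
  note [simp] = regular_epi_Ar[OF em(1)] mono_Ar[OF em(2)] em(3,5)
  have [simp]: "Cod C m = Cod C g" using Cod_Cmp[of f g] Cod_Cmp[of e m] em(4) by simp
  obtain k where k: "k \<in> Ar C" "Dom C k = Cod C f" "Cod C k = Cod C e" "k \<cdot> f = e"
  proof (rule regular_epi_factor[OF f, of e])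
    fix u v assume uv [simp]: "u \<in> Ar C" "v \<in> Ar C" "Cod C u = Dom C f" "Cod C v = Dom C f"
      "Dom C v = Dom C u" and eq: "f \<cdot> u = f \<cdot> v"
    have "m \<cdot> (e \<cdot> u) = m \<cdot> (e \<cdot> v)"
      using Cmp_extend[OF em(4)[symmetric], of u] Cmp_extend[OF em(4)[symmetric], of v] eq
      by (simp add: assoc)
    then show "e \<cdot> u = e \<cdot> v" by - (rule monoD[OF em(2)], auto)
  qed auto
  note [simp] = k(1-3)
  have "(m \<cdot> k) \<cdot> f = g \<cdot> f" using k(4) em(4) by (simp add: assoc)
  then have "m \<cdot> k = g" by - (rule regular_epi_cancel[OF f], auto)
  then have "iso_arr C m" by (intro iso_if_regular_epi_factors[OF g em(2)]) auto
  then show ?thesis unfolding em(4) by (rule iso_Cmp_regular_epi[OF _ em(1,3)])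
qed

end

section \<open>Relations and generalized elements\<close>

context category
begin

lemma related_intro:
  assumes "h \<in> Ar C" "Cod C h = Dom C (fst r)" "fst r \<cdot> h = x" "snd r \<cdot> h = y"
  shows "related C r x y"
  using assms unfolding related_def by metis

lemma related_cases:
  assumes "related C r x y"
  obtains h where "h \<in> Ar C" "Cod C h = Dom C (fst r)" "fst r \<cdot> h = x" "snd r \<cdot> h = y"
  using assms unfolding related_def by metis

lemma relationD:
  assumes "is_relation C X Y r"
  shows "fst r \<in> Ar C" "snd r \<in> Ar C" "Dom C (snd r) = Dom C (fst r)"
    "Cod C (fst r) = X" "Cod C (snd r) = Y"
proof -
  obtain q1 q2 m where q: "is_product C X Y q1 q2" and m: "mono_arr C m" "Cod C m = Dom C q1"
    and r: "r = (q1 \<cdot> m, q2 \<cdot> m)"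
    using assms unfolding is_relation_def by metis
  note [simp] = productD[OF q] mono_Ar[OF m(1)] m(2)
  show "fst r \<in> Ar C" "snd r \<in> Ar C" "Dom C (snd r) = Dom C (fst r)"
    "Cod C (fst r) = X" "Cod C (snd r) = Y"
    by (simp_all add: r)
qed

text \<open>Joint monicity of the legs, in a form that mentions no product.\<close>

lemma relation_unique:
  assumes r: "is_relation C X Y r" and h: "h \<in> Ar C" "Cod C h = Dom C (fst r)"
    and k: "k \<in> Ar C" "Cod C k = Dom C (fst r)" "Dom C k = Dom C h"
    and eq: "fst r \<cdot> h = fst r \<cdot> k" "snd r \<cdot> h = snd r \<cdot> k"
  shows "h = k"
proof -
  obtain q1 q2 m where q: "is_product C X Y q1 q2" and m: "mono_arr C m" "Cod C m = Dom C q1"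
    and rm: "r = (q1 \<cdot> m, q2 \<cdot> m)"
    using r unfolding is_relation_def by metis
  have [simp]: "Cod C h = Dom C m" "Cod C k = Dom C m"
    using h(2) k(2) rm productD[OF q] m mono_Ar[OF m(1)] by simp_all
  note [simp] = productD[OF q] mono_Ar[OF m(1)] m(2) h(1) k(1,3)
  have "q1 \<cdot> (m \<cdot> h) = q1 \<cdot> (m \<cdot> k)" "q2 \<cdot> (m \<cdot> h) = q2 \<cdot> (m \<cdot> k)"
    using eq by (simp_all add: rm assoc)
  then have "m \<cdot> h = m \<cdot> k" by - (rule product_unique[OF q], simp_all)
  then show "h = k" by - (rule monoD[OF m(1)], simp_all)
qed

lemma relatedD:
  assumes r: "is_relation C X Y r" and xy: "related C r x y"
  shows "x \<in> Ar C" "y \<in> Ar C" "Dom C y = Dom C x" "Cod C x = X" "Cod C y = Y"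
proof -
  obtain h where h: "h \<in> Ar C" "Cod C h = Dom C (fst r)" "fst r \<cdot> h = x" "snd r \<cdot> h = y"
    by (rule related_cases[OF xy])
  note [simp] = relationD[OF r] h(1,2) 
  show "x \<in> Ar C" "y \<in> Ar C" "Dom C y = Dom C x" "Cod C x = X" "Cod C y = Y"
    unfolding h(3,4)[symmetric] by simp_all
qed

lemma related_Cmp:
  assumes r: "is_relation C X Y r" and xy: "related C r x y" and e: "e \<in> Ar C" "Cod C e = Dom C x"
  shows "related C r (x \<cdot> e) (y \<cdot> e)"
proof -
  obtain h where h: "h \<in> Ar C" "Cod C h = Dom C (fst r)" "fst r \<cdot> h = x" "snd r \<cdot> h = y"
    by (rule related_cases[OF xy])
  note [simp] = relationD[OF r] h(1,2) e(1)
  have [simp]: "Cod C e = Dom C h" using e(2) unfolding h(3)[symmetric] by simp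
  show ?thesis
    by (rule related_intro[of "h \<cdot> e"]) (simp_all add: h(3,4)[symmetric] assoc)
qed

text \<open>Describes an image by its legs and a cover \<open>e\<close> of its apex. Composites of
  relations and regular images are both unpacked through it.\<close>

lemma image_span:
  assumes q: "is_product C X Y q1 q2" and h: "h \<in> Ar C" "Cod C h = Dom C q1" and m: "is_image C h m"
  obtains e where "is_relation C X Y (q1 \<cdot> m, q2 \<cdot> m)" "regular_epi C e" "Dom C e = Dom C h"
    "Cod C e = Dom C (q1 \<cdot> m)" "(q1 \<cdot> m) \<cdot> e = q1 \<cdot> h" "(q2 \<cdot> m) \<cdot> e = q2 \<cdot> h"
proof -
  obtain e where e: "regular_epi C e" "Cod C e = Dom C m" "h = m \<cdot> e" and mono: "mono_arr C m"
    using m unfolding is_image_def by metis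
  note [simp] = productD[OF q] mono_Ar[OF mono] regular_epi_Ar[OF e(1)] e(2)
  have [simp]: "Cod C m = Dom C q1" using h(2) unfolding e(3) by simp
  show thesis
  proof (rule that[OF _ e(1)])
    show "is_relation C X Y (q1 \<cdot> m, q2 \<cdot> m)"
      unfolding is_relation_def using q mono \<open>Cod C m = Dom C q1\<close> by metis
  qed (simp_all add: e(3) assoc)
qed

end

context regular_category
begin

text \<open>Membership in a relation may be checked on a cover: joint monicity of the legs shows
  that the witness \<open>h\<close> identifies whatever \<open>e\<close> does, so it descends along
  \<open>e\<close>.\<close>

lemma related_descend:
  assumes r: "is_relation C X Y r" and e: "regular_epi C e"
    and x: "x \<in> Ar C" "Dom C x = Cod C e" and y: "y \<in> Ar C" "Dom C y = Cod C e"
    and xy: "related C r (x \<cdot> e) (y \<cdot> e)"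
  shows "related C r x y"
proof -
  note [simp] = relationD[OF r] regular_epi_Ar[OF e] x y
  obtain h where h: "h \<in> Ar C" "Cod C h = Dom C (fst r)" "fst r \<cdot> h = x \<cdot> e" "snd r \<cdot> h = y \<cdot> e"
    by (rule related_cases[OF xy])
  note [simp] = h(1,2)
  have [simp]: "Dom C h = Dom C e" using h(3) Dom_Cmp[of h "fst r"] by simp
  obtain k where k: "k \<in> Ar C" "Dom C k = Cod C e" "Cod C k = Cod C h" "k \<cdot> e = h"
  proof (rule regular_epi_factor[OF e h(1)])
    fix u v assume uv [simp]: "u \<in> Ar C" "v \<in> Ar C" "Cod C u = Dom C e" "Cod C v = Dom C e"
      "Dom C v = Dom C u" and eq: "e \<cdot> u = e \<cdot> v"
    have "fst r \<cdot> (h \<cdot> u) = fst r \<cdot> (h \<cdot> v)"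
      using Cmp_extend[OF h(3), of u] Cmp_extend[OF h(3), of v] eq by (simp add: assoc)
    moreover have "snd r \<cdot> (h \<cdot> u) = snd r \<cdot> (h \<cdot> v)"
      using Cmp_extend[OF h(4), of u] Cmp_extend[OF h(4), of v] eq by (simp add: assoc)
    ultimately show "h \<cdot> u = h \<cdot> v" by - (rule relation_unique[OF r], simp_all)
  qed simp_all
  note [simp] = k(1-3)
  have "(fst r \<cdot> k) \<cdot> e = x \<cdot> e" "(snd r \<cdot> k) \<cdot> e = y \<cdot> e"
    using h(3,4) by (simp_all add: assoc k(4))
  then have "fst r \<cdot> k = x" "snd r \<cdot> k = y"
    by - (rule regular_epi_cancel[OF e], simp_all)+
  then show ?thesis by (intro related_intro[of k]) simp_all
qed

text \<open>The pairing of the legs into a chosen product is mono. Kernel pairs are recognised as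
  relations in this way.\<close>

lemma relation_if_jointly_monic:
  assumes D: "fst r \<in> Ar C" "snd r \<in> Ar C" "Dom C (snd r) = Dom C (fst r)"
    "Cod C (fst r) = X" "Cod C (snd r) = Y"
    and u: "\<And>h k. \<lbrakk>h \<in> Ar C; k \<in> Ar C; Cod C h = Dom C (fst r); Cod C k = Dom C (fst r);
      Dom C k = Dom C h; fst r \<cdot> h = fst r \<cdot> k; snd r \<cdot> h = snd r \<cdot> k\<rbrakk> \<Longrightarrow> h = k"
  shows "is_relation C X Y r"
proof -
  have "X \<in> Ob C" "Y \<in> Ob C" using D by auto
  then obtain q1 q2 where q: "is_product C X Y q1 q2" using product_exists by metis
  obtain m where m: "m \<in> Ar C" "Dom C m = Dom C (fst r)" "Cod C m = Dom C q1"
      "q1 \<cdot> m = fst r" "q2 \<cdot> m = snd r"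
    using product_lift[OF q D(1,2,3,4,5)] by metis
  note [simp] = D(1-3) m(1-3) productD[OF q]
  have "mono_arr C m"
  proof (rule monoI[OF m(1)])
    fix a b assume ab: "a \<in> Ar C" "b \<in> Ar C" "Cod C a = Dom C m" "Cod C b = Dom C m"
      "Dom C b = Dom C a" "m \<cdot> a = m \<cdot> b"
    note [simp] = ab(1-5)
    have "fst r \<cdot> a = fst r \<cdot> b" "snd r \<cdot> a = snd r \<cdot> b"
      unfolding m(4,5)[symmetric] by (simp_all add: assoc ab(6))
    then show "a = b" by - (rule u, simp_all)
  qed
  then show ?thesis
    unfolding is_relation_def using q m(3-5) by (metis prod.collapse)
qed

text \<open>Eliminates the products and pairings from the regular image, leaving a relation
  \<open>t\<close> and a cover \<open>e\<close> compatible with the legs.\<close>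

lemma regular_image_span:
  assumes im: "is_regular_image C f r t" and r: "is_relation C X X r"
    and f: "f \<in> hom C X Y"
  obtains e where "is_relation C Y Y t" "regular_epi C e" "Dom C e = Dom C (fst r)"
    "Cod C e = Dom C (fst t)" "fst t \<cdot> e = f \<cdot> fst r" "snd t \<cdot> e = f \<cdot> snd r"
proof -
  have f: "f \<in> Ar C" "Dom C f = X" "Cod C f = Y" using f by (simp_all add: hom_def)
  obtain p1 p2 q1 q2 g ff m where
      p: "is_product C (Dom C f) (Dom C f) p1 p2" and q: "is_product C (Cod C f) (Cod C f) q1 q2"
      and g: "g \<in> hom C (Dom C (fst r)) (Dom C p1)" and pg: "p1 \<cdot> g = fst r" "p2 \<cdot> g = snd r"
      and ff: "ff \<in> hom C (Dom C p1) (Dom C q1)" and qf: "q1 \<cdot> ff = f \<cdot> p1" "q2 \<cdot> ff = f \<cdot> p2"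
      and m: "is_image C (ff \<cdot> g) m" and t: "t = (q1 \<cdot> m, q2 \<cdot> m)"
    using im unfolding is_regular_image_def by metis
  have g': "g \<in> Ar C" "Dom C g = Dom C (fst r)" "Cod C g = Dom C p1"
    and ff': "ff \<in> Ar C" "Dom C ff = Dom C p1" "Cod C ff = Dom C q1"
    using g ff by (simp_all add: hom_def)
  note [simp] = f g' ff' productD[OF p[unfolded f]] productD[OF q[unfolded f]]
  have "ff \<cdot> g \<in> Ar C" "Cod C (ff \<cdot> g) = Dom C q1" by simp_all
  then obtain e where e: "is_relation C Y Y (q1 \<cdot> m, q2 \<cdot> m)" "regular_epi C e"
      "Dom C e = Dom C (ff \<cdot> g)"
      "Cod C e = Dom C (q1 \<cdot> m)" "(q1 \<cdot> m) \<cdot> e = q1 \<cdot> (ff \<cdot> g)" "(q2 \<cdot> m) \<cdot> e = q2 \<cdot> (ff \<cdot> g)"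
    using image_span[OF q _ _ m] f(3) by metis
  have "q1 \<cdot> (ff \<cdot> g) = f \<cdot> fst r" "q2 \<cdot> (ff \<cdot> g) = f \<cdot> snd r"
    using Cmp_extend[OF qf(1), of g] Cmp_extend[OF qf(2), of g] by (simp_all add: assoc pg)
  with e show thesis by (intro that[of e]) (simp_all add: t)
qed

lemma related_lift:
  assumes t: "is_relation C X Y t" and e: "regular_epi C e" "Cod C e = Dom C (fst t)"
    and xy: "related C t x y"
  obtains c k where "regular_epi C c" "Cod C c = Dom C x" "k \<in> Ar C" "Dom C k = Dom C c"
    "Cod C k = Dom C e" "(fst t \<cdot> e) \<cdot> k = x \<cdot> c" "(snd t \<cdot> e) \<cdot> k = y \<cdot> c"
proof -
  obtain h where h: "h \<in> Ar C" "Cod C h = Dom C (fst t)" "fst t \<cdot> h = x" "snd t \<cdot> h = y"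
    by (rule related_cases[OF xy])
  obtain c k where c: "regular_epi C c" "Cod C c = Dom C h" "k \<in> Ar C" "Dom C k = Dom C c"
      "Cod C k = Dom C e" "e \<cdot> k = h \<cdot> c"
    using regular_epi_lift[OF e(1) h(1)] h(2) e(2) by metis
  note [simp] = relationD[OF t] h(1,2) c(2-5) regular_epi_Ar[OF c(1)] regular_epi_Ar[OF e(1)] e(2)
  have "Dom C x = Dom C h" unfolding h(3)[symmetric] by simp
  then show thesis
    by (intro that[OF c(1) _ c(3,4,5)]) (simp_all add: assoc c(6) h(3,4)[symmetric])
qed

section \<open>Composition of relations\<close>

text \<open>The axiom \<open>goursat\<close> speaks about given composites, so applying it requires
  their existence.\<close>

lemma composite_exists:
  assumes r: "is_relation C X Y r" and s: "is_relation C Y Z s"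
  obtains t where "is_composite C r s t"
proof -
  note [simp] = relationD[OF r] relationD[OF s]
  have "Cod C (fst s) = Cod C (snd r)" by simp
  then obtain p1 p2 where pb: "is_pullback C (snd r) (fst s) p1 p2"
    using pullback_exists[OF relationD(2)[OF r] relationD(1)[OF s]] by metis
  have "Cod C (fst r) \<in> Ob C" "Cod C (snd s) \<in> Ob C"
    using Ob_Cod relationD(1)[OF r] relationD(2)[OF s] by blast+
  then obtain q1 q2 where q: "is_product C (Cod C (fst r)) (Cod C (snd s)) q1 q2"
    using product_exists by metis
  note P = pullbackD(4-8)[OF pb]
  have "fst r \<cdot> p1 \<in> Ar C" "snd s \<cdot> p2 \<in> Ar C" "Dom C (snd s \<cdot> p2) = Dom C (fst r \<cdot> p1)"
      "Dom C (fst r \<cdot> p1) = Dom C p1"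
      "Cod C (fst r \<cdot> p1) = Cod C (fst r)" "Cod C (snd s \<cdot> p2) = Cod C (snd s)"
    using P by simp_all
  then obtain h where h: "h \<in> Ar C" "Dom C h = Dom C p1" "Cod C h = Dom C q1"
      "q1 \<cdot> h = fst r \<cdot> p1" "q2 \<cdot> h = snd s \<cdot> p2"
    using product_lift[OF q] by metis
  from factorisation[OF h(1)] obtain m where "is_image C h m"
    unfolding is_image_def by metis
  with pb q h have "is_composite C r s (q1 \<cdot> m, q2 \<cdot> m)"
    unfolding is_composite_def hom_iff by blast
  then show thesis ..
qed

lemma composite_span:
  assumes r: "is_relation C X Y r" and s: "is_relation C Y Z s" and t: "is_composite C r s t"
  obtains p1 p2 e where "is_pullback C (snd r) (fst s) p1 p2" "is_relation C X Z t" "regular_epi C e"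
    "Dom C e = Dom C p1" "Cod C e = Dom C (fst t)"
    "fst t \<cdot> e = fst r \<cdot> p1" "snd t \<cdot> e = snd s \<cdot> p2"
proof -
  obtain p1 p2 q1 q2 h m where pb: "is_pullback C (snd r) (fst s) p1 p2"
    and q: "is_product C X Z q1 q2" and h: "h \<in> hom C (Dom C p1) (Dom C q1)"
      "q1 \<cdot> h = fst r \<cdot> p1" "q2 \<cdot> h = snd s \<cdot> p2" and m: "is_image C h m"
    and tm: "t = (q1 \<cdot> m, q2 \<cdot> m)"
    using t unfolding is_composite_def relationD(4)[OF r] relationD(5)[OF s] by metis
  have h': "h \<in> Ar C" "Dom C h = Dom C p1" "Cod C h = Dom C q1" using h by (simp_all add: hom_def)
  from image_span[OF q h'(1,3) m] show thesis
    using that[OF pb] h(2,3) h'(2) by (auto simp: tm)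
qed

lemma composite_relation:
  assumes "is_relation C X Y r" "is_relation C Y Z s" "is_composite C r s t"
  shows "is_relation C X Z t"
  using composite_span[OF assms] by metis

lemma related_composite_intro:
  assumes r: "is_relation C X Y r" and s: "is_relation C Y Z s" and t: "is_composite C r s t"
    and xy: "related C r x y" and yz: "related C s y z"
  shows "related C t x z"
proof -
  obtain p1 p2 e where pb: "is_pullback C (snd r) (fst s) p1 p2" and tr: "is_relation C X Z t"
    and e: "regular_epi C e" "Dom C e = Dom C p1" "Cod C e = Dom C (fst t)"
    "fst t \<cdot> e = fst r \<cdot> p1" "snd t \<cdot> e = snd s \<cdot> p2"
    by (rule composite_span[OF r s t])
  obtain h where h: "h \<in> Ar C" "Cod C h = Dom C (fst r)" "fst r \<cdot> h = x" "snd r \<cdot> h = y"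
    by (rule related_cases[OF xy])
  obtain k where k: "k \<in> Ar C" "Cod C k = Dom C (fst s)" "fst s \<cdot> k = y" "snd s \<cdot> k = z"
    by (rule related_cases[OF yz])
  note [simp] = relationD[OF r] relationD[OF s] relationD[OF tr] h(1,2) k(1,2)
    pullbackD(4-8)[OF pb] regular_epi_Ar[OF e(1)] e(2,3)
  have "snd r \<cdot> h = fst s \<cdot> k" using h k by simp
  moreover have "Dom C k = Dom C h" using Dom_Cmp[of h "snd r"] Dom_Cmp[of k "fst s"] h k by simp
  ultimately obtain l where l: "l \<in> Ar C" "Cod C l = Dom C p1" "p1 \<cdot> l = h" "p2 \<cdot> l = k"
    using pullback_lift[OF pb h(1) k(1)] by (metis h(2) k(2) relationD(3)[OF r])
  note [simp] = l(1,2)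
  show ?thesis
  proof (rule related_intro[of "e \<cdot> l"])
    show "fst t \<cdot> (e \<cdot> l) = x" "snd t \<cdot> (e \<cdot> l) = z"
      using Cmp_extend[OF e(4), of l] Cmp_extend[OF e(5), of l] by (simp_all add: assoc l h(3) k(4))
  qed simp_all
qed

text \<open>The composite is an image of the pullback of pairs, so the middle element exists only
  after passing to a cover.\<close>

lemma related_composite_cases:
  assumes r: "is_relation C X Y r" and s: "is_relation C Y Z s" and t: "is_composite C r s t"
    and xz: "related C t x z"
  obtains c y where "regular_epi C c" "Cod C c = Dom C x" "related C r (x \<cdot> c) y" "related C s y (z \<cdot> c)"
proof -
  obtain p1 p2 e where pb: "is_pullback C (snd r) (fst s) p1 p2" and tr: "is_relation C X Z t"
    and e: "regular_epi C e" "Dom C e = Dom C p1" "Cod C e = Dom C (fst t)"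
    "fst t \<cdot> e = fst r \<cdot> p1" "snd t \<cdot> e = snd s \<cdot> p2"
    by (rule composite_span[OF r s t])
  obtain c k where c: "regular_epi C c" "Cod C c = Dom C x" and k: "k \<in> Ar C" "Dom C k = Dom C c"
    "Cod C k = Dom C e" "(fst t \<cdot> e) \<cdot> k = x \<cdot> c" "(snd t \<cdot> e) \<cdot> k = z \<cdot> c"
    by (rule related_lift[OF tr e(1,3) xz])
  note [simp] = relationD[OF r] relationD[OF s] k(1-3) e(2) pullbackD(4-8)[OF pb]
  have "related C r (x \<cdot> c) (snd r \<cdot> (p1 \<cdot> k))"
    by (rule related_intro[of "p1 \<cdot> k"]) (use k(4) in \<open>simp_all add: e(4) assoc\<close>)
  moreover have "related C s (snd r \<cdot> (p1 \<cdot> k)) (z \<cdot> c)"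
  proof (rule related_intro[of "p2 \<cdot> k"])
    show "fst s \<cdot> (p2 \<cdot> k) = snd r \<cdot> (p1 \<cdot> k)" using pullback_commutes[OF pb k(1)] by simp
  qed (use k(5) in \<open>simp_all add: e(5) assoc\<close>)
  ultimately show thesis using that c by metis
qed

section \<open>Equivalence relations and kernel pairs\<close>

lemma equivalence_relationD: "equivalence_relation C X r \<Longrightarrow> is_relation C X X r"
  by (simp add: equivalence_relation_def)

lemma related_refl:
  assumes r: "equivalence_relation C X r" and x: "x \<in> Ar C" "Cod C x = X"
  shows "related C r x x"
proof -
  obtain d where d: "d \<in> Ar C" "Dom C d = X" "Cod C d = Dom C (fst r)"
      "fst r \<cdot> d = Idt C X" "snd r \<cdot> d = Idt C X"
    using r unfolding equivalence_relation_def reflexive_relation_def hom_iff Bex_def by blast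
  note [simp] = relationD[OF equivalence_relationD[OF r]] d(1-3) x
  show ?thesis
    using Cmp_extend[OF d(4), of x] Cmp_extend[OF d(5), of x]
    by (intro related_intro[of "d \<cdot> x"]) simp_all
qed

lemma related_sym:
  assumes r: "equivalence_relation C X r" and xy: "related C r x y"
  shows "related C r y x"
proof -
  obtain d where d: "d \<in> Ar C" "Dom C d = Dom C (fst r)" "Cod C d = Dom C (fst r)"
      "fst r \<cdot> d = snd r" "snd r \<cdot> d = fst r"
    using r unfolding equivalence_relation_def symmetric_relation_def hom_iff Bex_def by blast
  obtain h where h: "h \<in> Ar C" "Cod C h = Dom C (fst r)" "fst r \<cdot> h = x" "snd r \<cdot> h = y"
    by (rule related_cases[OF xy])
  note [simp] = relationD[OF equivalence_relationD[OF r]] d(1-3) h(1,2)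
  show ?thesis
    using Cmp_extend[OF d(4), of h] Cmp_extend[OF d(5), of h] h(3,4)
    by (intro related_intro[of "d \<cdot> h"]) simp_all
qed

lemma related_trans:
  assumes r: "equivalence_relation C X r" and xy: "related C r x y" and yz: "related C r y z"
  shows "related C r x z"
proof -
  note R = relationD[OF equivalence_relationD[OF r]]
  obtain h where h: "h \<in> Ar C" "Cod C h = Dom C (fst r)" "fst r \<cdot> h = x" "snd r \<cdot> h = y"
    by (rule related_cases[OF xy])
  obtain k where k: "k \<in> Ar C" "Cod C k = Dom C (fst r)" "fst r \<cdot> k = y" "snd r \<cdot> k = z"
    by (rule related_cases[OF yz])
  obtain p1 p2 where pb: "is_pullback C (snd r) (fst r) p1 p2"
    using pullback_exists[OF R(2,1)] R by metis
  moreover have "transitive_relation C r" using r by (simp add: equivalence_relation_def)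
  ultimately have "\<exists>t\<in>hom C (Dom C p1) (Dom C (fst r)).
      fst r \<cdot> t = fst r \<cdot> p1 \<and> snd r \<cdot> t = snd r \<cdot> p2"
    unfolding transitive_relation_def by blast
  then obtain t where t: "t \<in> Ar C" "Dom C t = Dom C p1" "Cod C t = Dom C (fst r)"
      "fst r \<cdot> t = fst r \<cdot> p1" "snd r \<cdot> t = snd r \<cdot> p2"
    unfolding hom_iff Bex_def by blast
  note [simp] = R h(1,2) k(1,2) t(1-3) pullbackD(4-8)[OF pb]
  have "snd r \<cdot> h = fst r \<cdot> k" using h k by simp
  moreover have "Dom C k = Dom C h" using Dom_Cmp[of h "snd r"] Dom_Cmp[of k "fst r"] h k by simp
  ultimately obtain l where l: "l \<in> Ar C" "Cod C l = Dom C p1" "p1 \<cdot> l = h" "p2 \<cdot> l = k"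
    using pullback_lift[OF pb h(1) k(1)] by (metis h(2) k(2) R(3))
  note [simp] = l(1,2)
  show ?thesis
  proof (rule related_intro[of "t \<cdot> l"])
    show "fst r \<cdot> (t \<cdot> l) = x" "snd r \<cdot> (t \<cdot> l) = z"
      using Cmp_extend[OF t(4), of l] Cmp_extend[OF t(5), of l] by (simp_all add: assoc l h(3) k(4))
  qed simp_all
qed

text \<open>A Yoneda argument: the structure arrows are the witnesses obtained by applying the
  elementwise laws to generic elements, namely the identity of \<open>X\<close>, the legs of
  \<open>r\<close>, and the two projections of a pullback of composable pairs.\<close>

lemma equivalence_relationI:
  assumes r: "is_relation C X X r"
    and refl: "\<And>x. \<lbrakk>x \<in> Ar C; Cod C x = X\<rbrakk> \<Longrightarrow> related C r x x"
    and sym: "\<And>x y. related C r x y \<Longrightarrow> related C r y x"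
    and trans: "\<And>x y z. \<lbrakk>related C r x y; related C r y z\<rbrakk> \<Longrightarrow> related C r x z"
  shows "equivalence_relation C X r"
proof -
  note R = relationD[OF r]
  have X: "X \<in> Ob C" using R by auto
  note [simp] = R X
  have rr: "related C r (fst r) (snd r)"
    by (rule related_intro[of "Idt C (Dom C (fst r))"]) simp_all
  have "reflexive_relation C X r"
  proof -
    have "related C r (Idt C X) (Idt C X)" by (rule refl) simp_all
    then obtain h where h: "h \<in> Ar C" "Cod C h = Dom C (fst r)" "fst r \<cdot> h = Idt C X"
        "snd r \<cdot> h = Idt C X"
      by (rule related_cases)
    have "h \<in> hom C X (Dom C (fst r))"
      using h(1,2) arg_cong[OF h(3), of "Dom C"] by (simp add: hom_iff)
    then show ?thesis unfolding reflexive_relation_def by (intro bexI[of _ h] conjI h(3,4))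
  qed
  moreover have "symmetric_relation C r"
  proof -
    obtain h where h: "h \<in> Ar C" "Cod C h = Dom C (fst r)" "fst r \<cdot> h = snd r" "snd r \<cdot> h = fst r"
      by (rule related_cases[OF sym[OF rr]])
    have "h \<in> hom C (Dom C (fst r)) (Dom C (fst r))"
      using h(1,2) arg_cong[OF h(3), of "Dom C"] by (simp add: hom_iff)
    then show ?thesis unfolding symmetric_relation_def by (intro bexI[of _ h] conjI h(3,4))
  qed
  moreover have "transitive_relation C r"
    unfolding transitive_relation_def
  proof (intro allI impI)
    fix p1 p2 assume pb: "is_pullback C (snd r) (fst r) p1 p2"
    note [simp] = pullbackD(4-8)[OF pb]
    have "related C r (fst r \<cdot> p1) (snd r \<cdot> p1)"
      by (rule related_intro[of p1]) simp_all
    moreover have "related C r (snd r \<cdot> p1) (snd r \<cdot> p2)"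
      by (rule related_intro[of p2]) (simp_all add: pullbackD(9)[OF pb])
    ultimately have "related C r (fst r \<cdot> p1) (snd r \<cdot> p2)" by (rule trans)
    then obtain h where h: "h \<in> Ar C" "Cod C h = Dom C (fst r)" "fst r \<cdot> h = fst r \<cdot> p1"
        "snd r \<cdot> h = snd r \<cdot> p2"
      by (rule related_cases)
    have "h \<in> hom C (Dom C p1) (Dom C (fst r))"
      using h(1,2) arg_cong[OF h(3), of "Dom C"] by (simp add: hom_iff)
    then show "\<exists>t\<in>hom C (Dom C p1) (Dom C (fst r)). fst r \<cdot> t = fst r \<cdot> p1 \<and> snd r \<cdot> t = snd r \<cdot> p2"
      by (intro bexI[of _ h] conjI h(3,4))
  qed
  ultimately show ?thesis using r by (simp add: equivalence_relation_def)
qed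

lemma related_kernel_pair:
  assumes pb: "is_pullback C f f u v"
  shows "related C (u, v) x y \<longleftrightarrow>
    x \<in> Ar C \<and> y \<in> Ar C \<and> Cod C x = Dom C f \<and> Cod C y = Dom C f \<and> Dom C y = Dom C x \<and> f \<cdot> x = f \<cdot> y"
proof
  assume "related C (u, v) x y"
  then obtain h where h: "h \<in> Ar C" "Cod C h = Dom C u" "u \<cdot> h = x" "v \<cdot> h = y"
    by (rule related_cases) simp
  note [simp] = h(1,2) pullbackD(4-8)[OF pb]
  show "x \<in> Ar C \<and> y \<in> Ar C \<and> Cod C x = Dom C f \<and> Cod C y = Dom C f \<and> Dom C y = Dom C x \<and> f \<cdot> x = f \<cdot> y"
    unfolding h(3,4)[symmetric] using pullback_commutes[OF pb, of h] by simp
next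
  assume "x \<in> Ar C \<and> y \<in> Ar C \<and> Cod C x = Dom C f \<and> Cod C y = Dom C f \<and> Dom C y = Dom C x \<and> f \<cdot> x = f \<cdot> y"
  then obtain h where "h \<in> Ar C" "Cod C h = Dom C u" "u \<cdot> h = x" "v \<cdot> h = y"
    using pullback_lift[OF pb, of x y] by metis
  then show "related C (u, v) x y" by (intro related_intro[of h]) simp_all
qed

lemma kernel_pair_equivalence:
  assumes pb: "is_pullback C f f u v"
  shows "equivalence_relation C (Dom C f) (u, v)"
proof (rule equivalence_relationI)
  show "is_relation C (Dom C f) (Dom C f) (u, v)"
    by (rule relation_if_jointly_monic) (use pullbackD(4-8)[OF pb] pullback_unique[OF pb] in simp_all)
qed (auto simp: related_kernel_pair[OF pb])

end

section \<open>Consequences of the Goursat condition\<close>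

context regular_category
begin

text \<open>The kernel pair of \<open>g\<close> is the intersection of those of \<open>a\<close> and
  \<open>b\<close>, so facts about kernel pairs of single arrows also cover intersections.\<close>

lemma pairing_exists:
  assumes a: "a \<in> hom C P A" and b: "b \<in> hom C P B"
  obtains g where "g \<in> Ar C" "Dom C g = P"
    "\<And>T x y. \<lbrakk>x \<in> hom C T P; y \<in> hom C T P\<rbrakk> \<Longrightarrow> g \<cdot> x = g \<cdot> y \<longleftrightarrow> a \<cdot> x = a \<cdot> y \<and> b \<cdot> x = b \<cdot> y"
proof -
  have [simp]: "a \<in> Ar C" "Dom C a = P" "Cod C a = A" "b \<in> Ar C" "Dom C b = P" "Cod C b = B"
    using a b by (simp_all add: hom_iff)
  have "A \<in> Ob C" "B \<in> Ob C" using Ob_Cod[of a] Ob_Cod[of b] by simp_all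
  then obtain q1 q2 where q: "is_product C A B q1 q2" using product_exists by metis
  obtain g where g: "g \<in> Ar C" "Dom C g = P" "Cod C g = Dom C q1" "q1 \<cdot> g = a" "q2 \<cdot> g = b"
    using product_lift[OF q, of a b] by auto
  note [simp] = g(1-3) productD[OF q]
  show thesis
  proof (rule that[OF g(1,2)])
    fix T x y assume "x \<in> hom C T P" "y \<in> hom C T P"
    then have [simp]: "x \<in> Ar C" "Dom C x = T" "Cod C x = P" "y \<in> Ar C" "Dom C y = T" "Cod C y = P"
      by (simp_all add: hom_iff)
    have "g \<cdot> x = g \<cdot> y" if "q1 \<cdot> (g \<cdot> x) = q1 \<cdot> (g \<cdot> y)" "q2 \<cdot> (g \<cdot> x) = q2 \<cdot> (g \<cdot> y)"
      by (rule product_unique[OF q]) (use that in simp_all)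
    then show "g \<cdot> x = g \<cdot> y \<longleftrightarrow> a \<cdot> x = a \<cdot> y \<and> b \<cdot> x = b \<cdot> y"
      unfolding g(4,5)[symmetric] by (auto simp: assoc)
  qed
qed

end

section \<open>The elementwise Goursat condition, the shifting property, and pullbacks of split
  epimorphisms\<close>

context goursat_category
begin

text \<open>The pair \<open>(x, w)\<close> lies in \<open>R S R\<close>, hence in
  \<open>S R S\<close>; unfolding the latter composite yields \<open>u\<close> and \<open>v\<close>
  on a cover.\<close>

lemma goursat_related:
  assumes r: "equivalence_relation C X r" and s: "equivalence_relation C X s"
    and xy: "related C r x y" and yz: "related C s y z" and zw: "related C r z w"
  obtains e u v where "regular_epi C e" "Cod C e = Dom C x"
    "related C s (x \<cdot> e) u" "related C r u v" "related C s v (w \<cdot> e)"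
proof -
  note R = equivalence_relationD[OF r] and S = equivalence_relationD[OF s]
  obtain sr where sr: "is_composite C r s sr" by (rule composite_exists[OF R S])
  note SR = composite_relation[OF R S sr]
  obtain rsr where rsr: "is_composite C sr r rsr" by (rule composite_exists[OF SR R])
  note RSR = composite_relation[OF SR R rsr]
  obtain rs where rs: "is_composite C s r rs" by (rule composite_exists[OF S R])
  note RS = composite_relation[OF S R rs]
  obtain srs where srs: "is_composite C rs s srs" by (rule composite_exists[OF RS S])
  note SRS = composite_relation[OF RS S srs]
  have "related C sr x z" by (rule related_composite_intro[OF R S sr xy yz])
  then have "related C rsr x w" by (rule related_composite_intro[OF SR R rsr _ zw])
  then obtain h where h: "h \<in> Ar C" "Cod C h = Dom C (fst rsr)" "fst rsr \<cdot> h = x" "snd rsr \<cdot> h = w"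
    by (rule related_cases)
  have "same_relation C rsr srs" by (rule goursat[OF r s sr rsr rs srs])
  then obtain i where i: "i \<in> Ar C" "Dom C i = Dom C (fst rsr)" "Cod C i = Dom C (fst srs)"
      "fst srs \<cdot> i = fst rsr" "snd srs \<cdot> i = snd rsr"
    unfolding same_relation_def hom_iff by blast
  note [simp] = relationD[OF RSR] relationD[OF SRS] h(1,2) i(1-3)
  have "related C srs x w"
  proof (rule related_intro[of "i \<cdot> h"])
    show "fst srs \<cdot> (i \<cdot> h) = x" "snd srs \<cdot> (i \<cdot> h) = w"
      using Cmp_extend[OF i(4), of h] Cmp_extend[OF i(5), of h] h(3,4) by simp_all
  qed simp_all
  \<comment> \<open>The triple composite is taken apart from the outside: \<open>v\<close> appears
    over the cover \<open>c\<close>, then \<open>u\<close> over a further cover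
    \<open>d\<close>.\<close>
  then obtain c v where c: "regular_epi C c" "Cod C c = Dom C x"
      and cv: "related C rs (x \<cdot> c) v" "related C s v (w \<cdot> c)"
    by (rule related_composite_cases[OF RS S srs])
  obtain d u where d: "regular_epi C d" "Cod C d = Dom C (x \<cdot> c)"
      and du: "related C s ((x \<cdot> c) \<cdot> d) u" "related C r u (v \<cdot> d)"
    by (rule related_composite_cases[OF S R rs cv(1)])
  note [simp] = relatedD[OF R xy] relatedD[OF R zw] relatedD[OF S yz] regular_epi_Ar[OF c(1)]
    regular_epi_Ar[OF d(1)] c(2)
  have dc: "Cod C d = Dom C c" using d(2) by simp
  have "related C s (v \<cdot> d) ((w \<cdot> c) \<cdot> d)"
    by (rule related_Cmp[OF S cv(2)]) (use d(2) relatedD(3)[OF RS cv(1)] in simp_all)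
  then show thesis
    using that[OF regular_epi_Cmp[OF d(1) c(1) dc] _ _ du(2)] du(1) dc by (simp add: assoc)
qed

text \<open>The same condition for the kernel pairs of \<open>f\<close> and \<open>g\<close>, stated
  purely by equations between arrows.\<close>

lemma goursat_kernel:
  assumes f: "f \<in> Ar C" "Dom C f = A" and g: "g \<in> Ar C" "Dom C g = A"
    and x: "x \<in> hom C T A" and y: "y \<in> hom C T A" and z: "z \<in> hom C T A" and w: "w \<in> hom C T A"
    and eq: "f \<cdot> x = f \<cdot> y" "g \<cdot> y = g \<cdot> z" "f \<cdot> z = f \<cdot> w"
  obtains e u v where "regular_epi C e" "Cod C e = T" "u \<in> hom C (Dom C e) A" "v \<in> hom C (Dom C e) A"
    "g \<cdot> (x \<cdot> e) = g \<cdot> u" "f \<cdot> u = f \<cdot> v" "g \<cdot> v = g \<cdot> (w \<cdot> e)"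
proof -
  obtain f1 f2 where pf: "is_pullback C f f f1 f2" using pullback_exists[OF f(1) f(1)] by blast
  obtain g1 g2 where pg: "is_pullback C g g g1 g2" using pullback_exists[OF g(1) g(1)] by blast
  note [simp] = f g x[unfolded hom_iff] y[unfolded hom_iff] z[unfolded hom_iff] w[unfolded hom_iff]
  have F: "equivalence_relation C A (f1, f2)" using kernel_pair_equivalence[OF pf] by simp
  have G: "equivalence_relation C A (g1, g2)" using kernel_pair_equivalence[OF pg] by simp
  have "related C (f1, f2) x y" "related C (g1, g2) y z" "related C (f1, f2) z w"
    using eq by (simp_all add: related_kernel_pair[OF pf] related_kernel_pair[OF pg])
  then obtain e u v where e: "regular_epi C e" "Cod C e = Dom C x"
    and r: "related C (g1, g2) (x \<cdot> e) u" "related C (f1, f2) u v" "related C (g1, g2) v (w \<cdot> e)"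
    by (rule goursat_related[OF F G])
  note [simp] = regular_epi_Ar[OF e(1)] e(2)
  show thesis
    using r by (intro that[OF e(1), of u v])
      (simp_all add: related_kernel_pair[OF pf] related_kernel_pair[OF pg] hom_iff)
qed

text \<open>Gumm's shifting property for the kernel pairs of \<open>\<alpha>\<close>,
  \<open>\<beta>\<close>, \<open>\<gamma>\<close>, where \<open>meet\<close> says that the
  intersection of the first two lies in the third. The elements form a square with
  \<open>\<alpha>\<close>-sides \<open>a b\<close> and \<open>c d\<close> and
  \<open>\<beta>\<close>-sides \<open>a c\<close> and \<open>b d\<close>; the
  \<open>\<gamma>\<close>-relation is moved from \<open>c d\<close> to \<open>a b\<close>.\<close>

lemma shifting:
  assumes \<alpha>: "\<alpha> \<in> Ar C" "Dom C \<alpha> = P" and \<beta>: "\<beta> \<in> Ar C" "Dom C \<beta> = P"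
    and \<gamma>: "\<gamma> \<in> Ar C" "Dom C \<gamma> = P"
    and a: "a \<in> hom C T P" and b: "b \<in> hom C T P" and c: "c \<in> hom C T P" and d: "d \<in> hom C T P"
    and eq: "\<alpha> \<cdot> a = \<alpha> \<cdot> b" "\<alpha> \<cdot> c = \<alpha> \<cdot> d" "\<beta> \<cdot> a = \<beta> \<cdot> c" "\<beta> \<cdot> b = \<beta> \<cdot> d" "\<gamma> \<cdot> c = \<gamma> \<cdot> d"
    and meet: "\<And>S u v. \<lbrakk>u \<in> hom C S P; v \<in> hom C S P; \<alpha> \<cdot> u = \<alpha> \<cdot> v; \<beta> \<cdot> u = \<beta> \<cdot> v\<rbrakk> \<Longrightarrow> \<gamma> \<cdot> u = \<gamma> \<cdot> v"
  shows "\<gamma> \<cdot> a = \<gamma> \<cdot> b"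
proof -
  note [simp] = \<alpha> \<beta> \<gamma> a[unfolded hom_iff] b[unfolded hom_iff] c[unfolded hom_iff] d[unfolded hom_iff]
  have \<alpha>': "\<alpha> \<in> hom C P (Cod C \<alpha>)" and \<gamma>': "\<gamma> \<in> hom C P (Cod C \<gamma>)" by (simp_all add: hom_iff)
  \<comment> \<open>\<open>g\<close> represents the intersection of \<open>\<alpha>\<close> and
    \<open>\<gamma>\<close>. The chain \<open>a\<close>, \<open>c\<close>, \<open>d\<close>,
    \<open>b\<close> has links \<open>\<beta>\<close>, \<open>g\<close>, \<open>\<beta>\<close>, and
    Goursat exchanges it for one from \<open>a\<close> through \<open>u\<close>, \<open>v\<close> to
    \<open>b\<close> with links \<open>g\<close>, \<open>\<beta>\<close>, \<open>g\<close>.\<close>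
  obtain g where g: "g \<in> Ar C" "Dom C g = P" and
    gi: "\<And>S x y. \<lbrakk>x \<in> hom C S P; y \<in> hom C S P\<rbrakk>
      \<Longrightarrow> g \<cdot> x = g \<cdot> y \<longleftrightarrow> \<alpha> \<cdot> x = \<alpha> \<cdot> y \<and> \<gamma> \<cdot> x = \<gamma> \<cdot> y"
    by (rule pairing_exists[OF \<alpha>' \<gamma>']) metis
  have "g \<cdot> c = g \<cdot> d" using gi[OF c d] eq by simp
  then obtain e u v where e: "regular_epi C e" "Cod C e = T"
    and u: "u \<in> hom C (Dom C e) P" and v: "v \<in> hom C (Dom C e) P"
    and uv: "g \<cdot> (a \<cdot> e) = g \<cdot> u" "\<beta> \<cdot> u = \<beta> \<cdot> v" "g \<cdot> v = g \<cdot> (b \<cdot> e)"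
    by (rule goursat_kernel[OF \<beta> g a c d b eq(3) _ eq(4)[symmetric]])
  note [simp] = regular_epi_Ar[OF e(1)] e(2)
  have ae: "a \<cdot> e \<in> hom C (Dom C e) P" and be: "b \<cdot> e \<in> hom C (Dom C e) P"
    by (simp_all add: hom_iff)
  note au = iffD1[OF gi[OF ae u] uv(1)] and vb = iffD1[OF gi[OF v be] uv(3)]
  \<comment> \<open>All four elements of the new chain agree under \<open>\<alpha>\<close>, so
    \<open>u\<close> and \<open>v\<close> agree under both \<open>\<alpha>\<close> and
    \<open>\<beta>\<close> and \<open>meet\<close> applies to them.\<close>
  have "\<alpha> \<cdot> (a \<cdot> e) = \<alpha> \<cdot> (b \<cdot> e)" using Cmp_extend[OF eq(1), of e] by (simp add: assoc)
  then have "\<alpha> \<cdot> u = \<alpha> \<cdot> v" using au vb by metis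
  then have "\<gamma> \<cdot> u = \<gamma> \<cdot> v" by (rule meet[OF u v _ uv(2)])
  then have "\<gamma> \<cdot> (a \<cdot> e) = \<gamma> \<cdot> (b \<cdot> e)" using au vb by metis
  then have "(\<gamma> \<cdot> a) \<cdot> e = (\<gamma> \<cdot> b) \<cdot> e" by (simp add: assoc)
  then show ?thesis by - (rule regular_epi_cancel[OF e(1)], simp_all)
qed

text \<open>The arrows \<open>\<alpha>\<close>, \<open>\<beta>\<close>, \<open>\<delta>\<close> map
  the cospan \<open>g\<close>, \<open>h\<close> to the cospan \<open>g'\<close>, \<open>h'\<close>
  compatibly with the splittings; an element \<open>(x, y)\<close> of the lower pullback is lifted
  to the upper one. Lifting \<open>x\<close> and \<open>y\<close> separately does not suffice, since
  the lifts need not meet over \<open>B\<close>.\<close>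

lemma pullback_split_cover:
  assumes g: "g \<in> hom C A B" and h: "h \<in> hom C D B" and t: "t \<in> hom C B A" and s: "s \<in> hom C B D"
    and g': "g' \<in> hom C A' B'" and h': "h' \<in> hom C D' B'" and t': "t' \<in> hom C B' A'" and s': "s' \<in> hom C B' D'"
    and \<alpha>: "\<alpha> \<in> hom C A A'" "regular_epi C \<alpha>" and \<beta>: "\<beta> \<in> hom C B B'"
    and \<delta>: "\<delta> \<in> hom C D D'" "regular_epi C \<delta>"
    and split: "g \<cdot> t = Idt C B" "h \<cdot> s = Idt C B"
    and nat: "g' \<cdot> \<alpha> = \<beta> \<cdot> g" "h' \<cdot> \<delta> = \<beta> \<cdot> h" "\<alpha> \<cdot> t = t' \<cdot> \<beta>" "\<delta> \<cdot> s = s' \<cdot> \<beta>"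
    and x: "x \<in> hom C T A'" and y: "y \<in> hom C T D'" and xy: "g' \<cdot> x = h' \<cdot> y"
  obtains e a d where "regular_epi C e" "Cod C e = T" "a \<in> hom C (Dom C e) A" "d \<in> hom C (Dom C e) D"
    "g \<cdot> a = h \<cdot> d" "\<alpha> \<cdot> a = x \<cdot> e" "\<delta> \<cdot> d = y \<cdot> e"
proof -
  note [simp] = g[unfolded hom_iff] h[unfolded hom_iff] t[unfolded hom_iff] s[unfolded hom_iff]
    g'[unfolded hom_iff] h'[unfolded hom_iff] t'[unfolded hom_iff] s'[unfolded hom_iff]
    \<alpha>(1)[unfolded hom_iff] \<beta>[unfolded hom_iff] \<delta>(1)[unfolded hom_iff]
    x[unfolded hom_iff] y[unfolded hom_iff]
  obtain c1 a1 where c1: "regular_epi C c1" "Cod C c1 = T" "a1 \<in> Ar C" "Dom C a1 = Dom C c1"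
      "Cod C a1 = A" "\<alpha> \<cdot> a1 = x \<cdot> c1"
    using regular_epi_lift[OF \<alpha>(2), of x] by auto
  note [simp] = regular_epi_Ar[OF c1(1)] c1(2-5)
  obtain c2 d1 where c2: "regular_epi C c2" "Cod C c2 = Dom C c1" "d1 \<in> Ar C" "Dom C d1 = Dom C c2"
      "Cod C d1 = D" "\<delta> \<cdot> d1 = (y \<cdot> c1) \<cdot> c2"
    using regular_epi_lift[OF \<delta>(2), of "y \<cdot> c1"] by auto
  note [simp] = regular_epi_Ar[OF c2(1)] c2(2-5)
  define c where "c = c1 \<cdot> c2"
  have c: "regular_epi C c" unfolding c_def by (rule regular_epi_Cmp[OF c2(1) c1(1) c2(2)])
  have [simp]: "c \<in> Ar C" "Cod C c = T" "Dom C c = Dom C c2" by (simp_all add: c_def)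
  define a0 where "a0 = a1 \<cdot> c2"
  have [simp]: "a0 \<in> Ar C" "Dom C a0 = Dom C c2" "Cod C a0 = A" by (simp_all add: a0_def)
  have a0: "\<alpha> \<cdot> a0 = x \<cdot> c" using Cmp_extend[OF c1(6), of c2] by (simp add: a0_def c_def assoc)
  have d1: "\<delta> \<cdot> d1 = y \<cdot> c" using c2(6) by (simp add: c_def assoc)
  \<comment> \<open>The separate lifts \<open>a0\<close> and \<open>d1\<close> are so far known to
    meet only after applying \<open>\<beta>\<close>; the remaining argument repairs this.\<close>
  have b: "\<beta> \<cdot> (g \<cdot> a0) = \<beta> \<cdot> (h \<cdot> d1)"
  proof -
    have "\<beta> \<cdot> (g \<cdot> a0) = g' \<cdot> (x \<cdot> c)" using Cmp_extend[OF nat(1), of a0] by (simp add: assoc a0)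
    also have "\<dots> = h' \<cdot> (y \<cdot> c)" using Cmp_extend[OF xy, of c] by (simp add: assoc)
    also have "\<dots> = \<beta> \<cdot> (h \<cdot> d1)" using Cmp_extend[OF nat(2), of d1] by (simp add: assoc d1)
    finally show ?thesis .
  qed
  obtain p1 p2 where pb: "is_pullback C g h p1 p2" using pullback_exists[of g h] by auto
  define P where "P = Dom C p1"
  have [simp]: "p1 \<in> Ar C" "Dom C p1 = P" "Cod C p1 = A" "p2 \<in> Ar C" "Dom C p2 = P" "Cod C p2 = D"
    using pullbackD(4-8)[OF pb] by (simp_all add: P_def)
  have el: "\<exists>w\<in>hom C (Dom C c2) P. p1 \<cdot> w = u \<and> p2 \<cdot> w = v"
    if "u \<in> hom C (Dom C c2) A" "v \<in> hom C (Dom C c2) D" "g \<cdot> u = h \<cdot> v" for u v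
  proof -
    have "u \<in> Ar C" "v \<in> Ar C" "Dom C v = Dom C u" "Cod C u = Dom C g" "Cod C v = Dom C h"
        "g \<cdot> u = h \<cdot> v"
      using that by (simp_all add: hom_iff)
    then obtain w where "w \<in> Ar C" "Dom C w = Dom C u" "Cod C w = Dom C p1" "p1 \<cdot> w = u" "p2 \<cdot> w = v"
      by (rule pullback_lift[OF pb])
    then show ?thesis using that(1) by (intro bexI[of _ w] conjI) (simp_all add: hom_iff)
  qed
  have gt: "g \<cdot> (t \<cdot> w) = w" "h \<cdot> (s \<cdot> w) = w" if "w \<in> Ar C" "Cod C w = B" for w
    using Cmp_extend[OF split(1), of w] Cmp_extend[OF split(2), of w] that by simp_all
  \<comment> \<open>The chain \<open>x0\<close>, \<open>x1\<close>, \<open>x2\<close>,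
    \<open>x3\<close> leads from \<open>a0\<close> to \<open>d1\<close> inside the pullback of
    \<open>g\<close> and \<open>h\<close>. Its outer links keep the image in \<open>B\<close>, while
    the middle link keeps the images in \<open>A'\<close> and \<open>D'\<close>.\<close>
  obtain x0 where x0: "x0 \<in> hom C (Dom C c2) P" "p1 \<cdot> x0 = a0" "p2 \<cdot> x0 = s \<cdot> (g \<cdot> a0)"
    using el[of a0 "s \<cdot> (g \<cdot> a0)"] by (auto simp: hom_iff gt)
  obtain x1 where x1: "x1 \<in> hom C (Dom C c2) P" "p1 \<cdot> x1 = t \<cdot> (g \<cdot> a0)" "p2 \<cdot> x1 = s \<cdot> (g \<cdot> a0)"
    using el[of "t \<cdot> (g \<cdot> a0)" "s \<cdot> (g \<cdot> a0)"] by (auto simp: hom_iff gt)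
  obtain x2 where x2: "x2 \<in> hom C (Dom C c2) P" "p1 \<cdot> x2 = t \<cdot> (h \<cdot> d1)" "p2 \<cdot> x2 = s \<cdot> (h \<cdot> d1)"
    using el[of "t \<cdot> (h \<cdot> d1)" "s \<cdot> (h \<cdot> d1)"] by (auto simp: hom_iff gt)
  obtain x3 where x3: "x3 \<in> hom C (Dom C c2) P" "p1 \<cdot> x3 = t \<cdot> (h \<cdot> d1)" "p2 \<cdot> x3 = d1"
    using el[of "t \<cdot> (h \<cdot> d1)" d1] by (auto simp: hom_iff gt)
  note [simp] = x0(1)[unfolded hom_iff] x1(1)[unfolded hom_iff] x2(1)[unfolded hom_iff] x3(1)[unfolded hom_iff]
  have ap: "\<alpha> \<cdot> p1 \<in> hom C P A'" and dp: "\<delta> \<cdot> p2 \<in> hom C P D'" by (simp_all add: hom_iff)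
  obtain F where F: "F \<in> Ar C" "Dom C F = P" and
    FI: "\<And>S u v. \<lbrakk>u \<in> hom C S P; v \<in> hom C S P\<rbrakk> \<Longrightarrow> F \<cdot> u = F \<cdot> v \<longleftrightarrow>
      (\<alpha> \<cdot> p1) \<cdot> u = (\<alpha> \<cdot> p1) \<cdot> v \<and> (\<delta> \<cdot> p2) \<cdot> u = (\<delta> \<cdot> p2) \<cdot> v"
    by (rule pairing_exists[OF ap dp]) metis
  have k: "(g \<cdot> p1) \<cdot> x0 = (g \<cdot> p1) \<cdot> x1" "(g \<cdot> p1) \<cdot> x2 = (g \<cdot> p1) \<cdot> x3"
    using x0 x1 x2 x3 by (simp_all add: assoc gt)
  \<comment> \<open>The middle link: the splittings are natural, so \<open>t\<close> and
    \<open>s\<close> send elements identified by \<open>\<beta>\<close> to elements identified by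
    \<open>\<alpha>\<close> and by \<open>\<delta>\<close>.\<close>
  have "\<alpha> \<cdot> (t \<cdot> (g \<cdot> a0)) = \<alpha> \<cdot> (t \<cdot> (h \<cdot> d1))"
    using Cmp_extend[OF nat(3), of "g \<cdot> a0"] Cmp_extend[OF nat(3), of "h \<cdot> d1"] by (simp add: assoc b)
  moreover have "\<delta> \<cdot> (s \<cdot> (g \<cdot> a0)) = \<delta> \<cdot> (s \<cdot> (h \<cdot> d1))"
    using Cmp_extend[OF nat(4), of "g \<cdot> a0"] Cmp_extend[OF nat(4), of "h \<cdot> d1"] by (simp add: assoc b)
  ultimately have "F \<cdot> x1 = F \<cdot> x2"
    unfolding FI[OF x1(1) x2(1)] using x1 x2 by (simp add: assoc)
  moreover have "g \<cdot> p1 \<in> Ar C" "Dom C (g \<cdot> p1) = P" by simp_all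
  ultimately obtain e u v where e: "regular_epi C e" "Cod C e = Dom C c2"
    and u: "u \<in> hom C (Dom C e) P" and v: "v \<in> hom C (Dom C e) P"
    and uv: "F \<cdot> (x0 \<cdot> e) = F \<cdot> u" "(g \<cdot> p1) \<cdot> u = (g \<cdot> p1) \<cdot> v" "F \<cdot> v = F \<cdot> (x3 \<cdot> e)"
    using goursat_kernel[OF _ _ F x0(1) x1(1) x2(1) x3(1) k(1) _ k(2)] by metis
  note [simp] = regular_epi_Ar[OF e(1)] e(2) u[unfolded hom_iff] v[unfolded hom_iff]
  have xe: "x0 \<cdot> e \<in> hom C (Dom C e) P" "x3 \<cdot> e \<in> hom C (Dom C e) P" by (simp_all add: hom_iff)
  \<comment> \<open>The lift takes its first component from \<open>u\<close> and its second from
    \<open>v\<close>: they lie over \<open>x\<close> and \<open>y\<close> respectively, and agree in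
    \<open>B\<close> because \<open>g \<cdot> p1\<close> identifies \<open>u\<close> with
    \<open>v\<close>.\<close>
  show thesis
  proof (rule that[of "c \<cdot> e" "p1 \<cdot> u" "p2 \<cdot> v"])
    show "regular_epi C (c \<cdot> e)" by (rule regular_epi_Cmp[OF e(1) c]) simp
    show "g \<cdot> (p1 \<cdot> u) = h \<cdot> (p2 \<cdot> v)"
      using uv(2) pullback_commutes[OF pb, of v] by (simp add: assoc)
    show "\<alpha> \<cdot> (p1 \<cdot> u) = x \<cdot> (c \<cdot> e)"
      using iffD1[OF FI[OF xe(1) u] uv(1)] Cmp_extend[OF x0(2), of e] Cmp_extend[OF a0, of e]
      by (simp add: assoc)
    show "\<delta> \<cdot> (p2 \<cdot> v) = y \<cdot> (c \<cdot> e)"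
      using iffD1[OF FI[OF v xe(2)] uv(3)] Cmp_extend[OF x3(3), of e] Cmp_extend[OF d1, of e]
      by (simp add: assoc)
  qed (simp_all add: hom_iff)
qed

end

section \<open>Regular images of equivalence relations\<close>

text \<open>The regular epi part of the factorisation that defines the regular image, described on
  legs so that no product has to be carried along.\<close>

definition image_map :: "('o, 'a) cat \<Rightarrow> 'a \<Rightarrow> 'a \<times> 'a \<Rightarrow> 'a \<times> 'a \<Rightarrow> 'a \<Rightarrow> bool" where
  "image_map C f r t e \<longleftrightarrow> regular_epi C e \<and> Dom C e = Dom C (fst r) \<and> Cod C e = Dom C (fst t) \<and>
     fst t \<cdot>\<^bsub>C\<^esub> e = f \<cdot>\<^bsub>C\<^esub> fst r \<and> snd t \<cdot>\<^bsub>C\<^esub> e = f \<cdot>\<^bsub>C\<^esub> snd r"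

context regular_category
begin

lemma related_image:
  assumes f: "f \<in> hom C X Y" and r: "is_relation C X X r" and t: "is_relation C Y Y t"
    and e: "image_map C f r t e" and xy: "related C r x y"
  shows "related C t (f \<cdot> x) (f \<cdot> y)"
proof -
  have e: "regular_epi C e" "Dom C e = Dom C (fst r)" "Cod C e = Dom C (fst t)"
      "fst t \<cdot> e = f \<cdot> fst r" "snd t \<cdot> e = f \<cdot> snd r"
    using e by (simp_all add: image_map_def)
  obtain h where h: "h \<in> Ar C" "Cod C h = Dom C (fst r)" "fst r \<cdot> h = x" "snd r \<cdot> h = y"
    by (rule related_cases[OF xy])
  note [simp] = relationD[OF r] relationD[OF t] h(1,2) regular_epi_Ar[OF e(1)] e(2,3) f[unfolded hom_iff]
  show ?thesis
    using Cmp_extend[OF e(4), of h] Cmp_extend[OF e(5), of h]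
    by (intro related_intro[of "e \<cdot> h"]) (simp_all add: assoc h(3,4))
qed

lemma related_image_lift:
  assumes f: "f \<in> hom C X Y" and r: "is_relation C X X r" and t: "is_relation C Y Y t"
    and e: "image_map C f r t e" and xy: "related C t x y"
  obtains c x' y' where "regular_epi C c" "Cod C c = Dom C x" "related C r x' y'"
    "f \<cdot> x' = x \<cdot> c" "f \<cdot> y' = y \<cdot> c" "Dom C x' = Dom C c"
proof -
  have e: "regular_epi C e" "Dom C e = Dom C (fst r)" "Cod C e = Dom C (fst t)"
      "fst t \<cdot> e = f \<cdot> fst r" "snd t \<cdot> e = f \<cdot> snd r"
    using e by (simp_all add: image_map_def)
  obtain c k where c: "regular_epi C c" "Cod C c = Dom C x" and k: "k \<in> Ar C" "Dom C k = Dom C c"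
    "Cod C k = Dom C e" "(fst t \<cdot> e) \<cdot> k = x \<cdot> c" "(snd t \<cdot> e) \<cdot> k = y \<cdot> c"
    by (rule related_lift[OF t e(1,3) xy])
  note [simp] = relationD[OF r] k(1-3) e(2) f[unfolded hom_iff]
  have "related C r (fst r \<cdot> k) (snd r \<cdot> k)" by (rule related_intro[of k]) simp_all
  then show thesis
    using k(4,5) by (intro that[OF c, of "fst r \<cdot> k" "snd r \<cdot> k"]) (simp_all add: e(4,5) assoc)
qed

end

context goursat_category
begin

text \<open>Reflexivity and symmetry are transferred along covers. Transitivity is where the Goursat
  condition enters, applied to \<open>r\<close> and the kernel pair of \<open>f\<close>.\<close>

lemma image_equivalence:
  assumes f: "f \<in> hom C X Y" "regular_epi C f" and r: "equivalence_relation C X r"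
    and t: "is_relation C Y Y t" and e: "image_map C f r t e"
  shows "equivalence_relation C Y t"
proof (rule equivalence_relationI[OF t])
  note R = equivalence_relationD[OF r]
  note [simp] = f(1)[unfolded hom_iff]
  fix x assume x: "x \<in> Ar C" "Cod C x = Y"
  obtain c y where c: "regular_epi C c" "Cod C c = Dom C x" "y \<in> Ar C" "Cod C y = X" "f \<cdot> y = x \<cdot> c"
    using regular_epi_lift[OF f(2) x(1)] x(2) f(1) unfolding hom_iff by metis
  have "related C t (x \<cdot> c) (x \<cdot> c)"
    using related_image[OF f(1) R t e related_refl[OF r c(3,4)]] c(5) by simp
  then show "related C t x x" using related_descend[OF t c(1)] x c(2) by metis
next
  note R = equivalence_relationD[OF r]
  fix x y assume xy: "related C t x y"
  obtain c x' y' where c: "regular_epi C c" "Cod C c = Dom C x" "related C r x' y'"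
    "f \<cdot> x' = x \<cdot> c" "f \<cdot> y' = y \<cdot> c"
    by (rule related_image_lift[OF f(1) R t e xy])
  have "related C t (y \<cdot> c) (x \<cdot> c)"
    using related_image[OF f(1) R t e related_sym[OF r c(3)]] c(4,5) by simp
  then show "related C t y x" using related_descend[OF t c(1)] relatedD[OF t xy] c(2) by metis
next
  note R = equivalence_relationD[OF r]
  note [simp] = f(1)[unfolded hom_iff]
  fix x y z assume xy: "related C t x y" and yz: "related C t y z"
  note [simp] = relatedD[OF t xy] relatedD[OF t yz]
  obtain c1 a b where c1: "regular_epi C c1" "Cod C c1 = Dom C x" and ab: "related C r a b"
    "f \<cdot> a = x \<cdot> c1" "f \<cdot> b = y \<cdot> c1" "Dom C a = Dom C c1"
    by (rule related_image_lift[OF f(1) R t e xy])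
  note [simp] = regular_epi_Ar[OF c1(1)] c1(2) ab(4) relatedD[OF R ab(1)]
  have "related C t (y \<cdot> c1) (z \<cdot> c1)" by (rule related_Cmp[OF t yz]) simp_all
  then obtain c2 b' d where c2: "regular_epi C c2" "Cod C c2 = Dom C (y \<cdot> c1)" and bd: "related C r b' d"
    "f \<cdot> b' = (y \<cdot> c1) \<cdot> c2" "f \<cdot> d = (z \<cdot> c1) \<cdot> c2" "Dom C b' = Dom C c2"
    by (rule related_image_lift[OF f(1) R t e])
  have c2c: "Cod C c2 = Dom C c1" using c2(2) by simp
  note [simp] = regular_epi_Ar[OF c2(1)] c2c bd(4) relatedD[OF R bd(1)]
  obtain f1 f2 where pf: "is_pullback C f f f1 f2" using pullback_exists[of f f] by auto
  have F: "equivalence_relation C X (f1, f2)" using kernel_pair_equivalence[OF pf] by simp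
  have ac: "related C r (a \<cdot> c2) (b \<cdot> c2)" by (rule related_Cmp[OF R ab(1)]) simp_all
  \<comment> \<open>The lifted pairs \<open>(a, b)\<close> and \<open>(b', d)\<close> have middle
    terms that agree only under \<open>f\<close>. Goursat turns this chain through \<open>r\<close>,
    the kernel pair, \<open>r\<close> into one through the kernel pair, \<open>r\<close>, the kernel
    pair, whose outer links disappear under \<open>f\<close>.\<close>
  have bb: "related C (f1, f2) (b \<cdot> c2) b'"
    using Cmp_extend[OF ab(3), of c2] bd(2) by (simp add: related_kernel_pair[OF pf])
  obtain c3 u v where c3: "regular_epi C c3" "Cod C c3 = Dom C (a \<cdot> c2)"
    and uv: "related C (f1, f2) ((a \<cdot> c2) \<cdot> c3) u" "related C r u v" "related C (f1, f2) v (d \<cdot> c3)"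
    by (rule goursat_related[OF r F ac bb bd(1)])
  have c3c: "Cod C c3 = Dom C c2" using c3(2) by simp
  note [simp] = regular_epi_Ar[OF c3(1)] c3c relatedD[OF R uv(2)]
  have c: "regular_epi C (c1 \<cdot> (c2 \<cdot> c3))"
    by (intro regular_epi_Cmp c1(1) c2(1) c3(1)) simp_all
  have "f \<cdot> u = x \<cdot> (c1 \<cdot> (c2 \<cdot> c3))"
    using uv(1) Cmp_extend[OF ab(2), of "c2 \<cdot> c3"] by (simp add: related_kernel_pair[OF pf] assoc)
  moreover have "f \<cdot> v = z \<cdot> (c1 \<cdot> (c2 \<cdot> c3))"
    using uv(3) Cmp_extend[OF bd(3), of "c3"] by (simp add: related_kernel_pair[OF pf] assoc)
  ultimately have "related C t (x \<cdot> (c1 \<cdot> (c2 \<cdot> c3))) (z \<cdot> (c1 \<cdot> (c2 \<cdot> c3)))"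
    using related_image[OF f(1) R t e uv(2)] by simp
  then show "related C t x z" by - (rule related_descend[OF t c], simp_all)
qed

end

section \<open>Connectors and regular images\<close>

text \<open>Formulated for arbitrary relations on one object, so that it can be interpreted both
  over \<open>X\<close> and over \<open>Y\<close>.\<close>

locale relation_pullback = regular_category C for C :: "('o, 'a) cat" (structure) +
  fixes X :: 'o and r s :: "'a \<times> 'a" and a b :: 'a
  assumes r: "is_relation C X X r" and s: "is_relation C X X s"
    and pb: "is_pullback C (snd r) (fst s) a b"
begin

abbreviation apex :: 'o where "apex \<equiv> Dom C a"

definition left :: 'a where "left = fst r \<cdot> a"
definition mid :: 'a where "mid = snd r \<cdot> a"
definition right :: 'a where "right = snd s \<cdot> b"

lemmas legs [simp] = relationD[OF r] relationD[OF s] pullbackD(4-8)[OF pb]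

lemma left_hom: "left \<in> hom C apex X"
  and mid_hom: "mid \<in> hom C apex X"
  and right_hom: "right \<in> hom C apex X"
  by (simp_all add: hom_iff left_def mid_def right_def)

lemmas projections [simp] = left_hom[unfolded hom_iff] mid_hom[unfolded hom_iff] right_hom[unfolded hom_iff]

lemma projections_Cmp:
  assumes "t \<in> Ar C" "Cod C t = apex"
  shows "left \<cdot> t = fst r \<cdot> (a \<cdot> t)" "mid \<cdot> t = snd r \<cdot> (a \<cdot> t)"
    "mid \<cdot> t = fst s \<cdot> (b \<cdot> t)" "right \<cdot> t = snd s \<cdot> (b \<cdot> t)"
  using assms pullback_commutes[OF pb assms] by (simp_all add: left_def mid_def right_def assoc)

text \<open>The coordinates determine the two related pairs by joint monicity of the legs, and these
  pairs determine the element of the pullback.\<close>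

lemma triple_unique:
  assumes t: "t \<in> hom C T apex" and u: "u \<in> hom C T apex"
    and eq: "left \<cdot> t = left \<cdot> u" "mid \<cdot> t = mid \<cdot> u" "right \<cdot> t = right \<cdot> u"
  shows "t = u"
proof -
  note [simp] = t[unfolded hom_iff] u[unfolded hom_iff]
  have "a \<cdot> t = a \<cdot> u"
    by (rule relation_unique[OF r])
      (use eq(1,2) in \<open>simp_all add: projections_Cmp(1,2)\<close>)
  moreover have "b \<cdot> t = b \<cdot> u"
    by (rule relation_unique[OF s])
      (use eq(2,3) in \<open>simp_all add: projections_Cmp(3,4)\<close>)
  ultimately show ?thesis by - (rule pullback_unique[OF pb], simp_all)
qed

lemma triple_exists:
  assumes xy: "related C r x y" and yz: "related C s y z"
  obtains t where "t \<in> hom C (Dom C x) apex" "left \<cdot> t = x" "mid \<cdot> t = y" "right \<cdot> t = z"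
proof -
  obtain h where h: "h \<in> Ar C" "Cod C h = Dom C (fst r)" "fst r \<cdot> h = x" "snd r \<cdot> h = y"
    by (rule related_cases[OF xy])
  obtain k where k: "k \<in> Ar C" "Cod C k = Dom C (fst s)" "fst s \<cdot> k = y" "snd s \<cdot> k = z"
    by (rule related_cases[OF yz])
  have hx: "Dom C h = Dom C x" using h(1,2) arg_cong[OF h(3), of "Dom C"] by simp
  have ky: "Dom C k = Dom C y" using k(1,2) arg_cong[OF k(3), of "Dom C"] by simp
  have "Dom C k = Dom C h" using hx ky relatedD(3)[OF r xy] by simp
  moreover have "Cod C h = Dom C (snd r)" using h(2) by simp
  moreover have "snd r \<cdot> h = fst s \<cdot> k" using h(4) k(3) by simp
  ultimately obtain t where t: "t \<in> Ar C" "Dom C t = Dom C h" "Cod C t = apex" "a \<cdot> t = h" "b \<cdot> t = k"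
    using pullback_lift[OF pb h(1) k(1) _ _ k(2)] by metis
  have "left \<cdot> t = x" "mid \<cdot> t = y" "right \<cdot> t = z"
    using projections_Cmp[OF t(1,3)] t(4,5) h(3,4) k(4) by simp_all
  then show thesis using t hx by (intro that[of t]) (simp_all add: hom_iff)
qed

lemma related_left_mid:
  assumes "t \<in> hom C T apex"
  shows "related C r (left \<cdot> t) (mid \<cdot> t)"
  by (rule related_intro[of "a \<cdot> t"]) (use assms[unfolded hom_iff] in \<open>simp_all add: projections_Cmp(1,2)\<close>)

lemma related_mid_right:
  assumes "t \<in> hom C T apex"
  shows "related C s (mid \<cdot> t) (right \<cdot> t)"
  by (rule related_intro[of "b \<cdot> t"]) (use assms[unfolded hom_iff] in \<open>simp_all add: projections_Cmp(3,4)\<close>)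

text \<open>Replaces the partial term by an actual element of the apex, so that the connector laws
  become statements about three coordinates.\<close>

lemma conn_val_iff:
  "conn_val C r s a b p x y z w \<longleftrightarrow>
    (\<exists>T. \<exists>t\<in>hom C T apex. left \<cdot> t = x \<and> mid \<cdot> t = y \<and> right \<cdot> t = z \<and> p \<cdot> t = w)"
proof
  assume "conn_val C r s a b p x y z w"
  then obtain t where t: "t \<in> Ar C" "Cod C t = apex" and
    v: "fst r \<cdot> (a \<cdot> t) = x" "snd r \<cdot> (a \<cdot> t) = y" "snd s \<cdot> (b \<cdot> t) = z" "p \<cdot> t = w"
    unfolding conn_val_def by blast
  have "t \<in> hom C (Dom C t) apex" using t by (simp add: hom_iff)
  then show "\<exists>T. \<exists>t\<in>hom C T apex. left \<cdot> t = x \<and> mid \<cdot> t = y \<and> right \<cdot> t = z \<and> p \<cdot> t = w"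
    using projections_Cmp(1,2,4)[OF t] v by metis
next
  assume "\<exists>T. \<exists>t\<in>hom C T apex. left \<cdot> t = x \<and> mid \<cdot> t = y \<and> right \<cdot> t = z \<and> p \<cdot> t = w"
  then obtain t where t: "t \<in> Ar C" "Cod C t = apex" and
    v: "left \<cdot> t = x" "mid \<cdot> t = y" "right \<cdot> t = z" "p \<cdot> t = w"
    unfolding hom_iff Bex_def by blast
  show "conn_val C r s a b p x y z w"
    unfolding conn_val_def using projections_Cmp[OF t] t v by metis
qed

lemma is_connectorD:
  assumes p: "is_connector C X r s a b p" and t: "t \<in> hom C T apex"
  shows "related C s (left \<cdot> t) (p \<cdot> t)" "related C r (p \<cdot> t) (right \<cdot> t)"
    "left \<cdot> t = mid \<cdot> t \<Longrightarrow> p \<cdot> t = right \<cdot> t"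
    "mid \<cdot> t = right \<cdot> t \<Longrightarrow> p \<cdot> t = left \<cdot> t"
proof -
  have v: "conn_val C r s a b p (left \<cdot> t) (mid \<cdot> t) (right \<cdot> t) (p \<cdot> t)"
    unfolding conn_val_iff using t by blast
  show "related C s (left \<cdot> t) (p \<cdot> t)" "related C r (p \<cdot> t) (right \<cdot> t)"
    using p v unfolding is_connector_def by blast+
  show "p \<cdot> t = right \<cdot> t" if "left \<cdot> t = mid \<cdot> t"
    using p v unfolding is_connector_def that by blast
  show "p \<cdot> t = left \<cdot> t" if "mid \<cdot> t = right \<cdot> t"
    using p v unfolding is_connector_def that by blast
qed

text \<open>Read \<open>t3 = (x,y,z)\<close>, \<open>t1 = (z,u,v)\<close>,
  \<open>t2 = (x,y,p(z,u,v))\<close> and \<open>t4 = (p(x,y,z),u,v)\<close>. The equations record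
  the coordinates that these triples share.\<close>

lemma is_connector_assoc:
  assumes p: "is_connector C X r s a b p"
    and t: "t1 \<in> hom C T apex" "t2 \<in> hom C T apex" "t3 \<in> hom C T apex" "t4 \<in> hom C T apex"
    and eq: "left \<cdot> t2 = left \<cdot> t3" "mid \<cdot> t2 = mid \<cdot> t3" "right \<cdot> t2 = p \<cdot> t1"
      "left \<cdot> t1 = right \<cdot> t3"
      "left \<cdot> t4 = p \<cdot> t3" "mid \<cdot> t4 = mid \<cdot> t1" "right \<cdot> t4 = right \<cdot> t1"
  shows "p \<cdot> t2 = p \<cdot> t4"
proof -
  have "conn_val C r s a b p (right \<cdot> t3) (mid \<cdot> t1) (right \<cdot> t1) (p \<cdot> t1)"
    "conn_val C r s a b p (left \<cdot> t3) (mid \<cdot> t3) (p \<cdot> t1) (p \<cdot> t2)"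
    "conn_val C r s a b p (left \<cdot> t3) (mid \<cdot> t3) (right \<cdot> t3) (p \<cdot> t3)"
    "conn_val C r s a b p (p \<cdot> t3) (mid \<cdot> t1) (right \<cdot> t1) (p \<cdot> t4)"
    unfolding conn_val_iff using t eq by metis+
  then show ?thesis using p unfolding is_connector_def by blast
qed

lemma is_connectorI:
  assumes eqv: "equivalence_relation C X r" "equivalence_relation C X s"
    and p: "p \<in> hom C apex X"
    and rel: "\<And>T t. t \<in> hom C T apex \<Longrightarrow> related C s (left \<cdot> t) (p \<cdot> t) \<and> related C r (p \<cdot> t) (right \<cdot> t)"
    and lm: "\<And>T t. \<lbrakk>t \<in> hom C T apex; left \<cdot> t = mid \<cdot> t\<rbrakk> \<Longrightarrow> p \<cdot> t = right \<cdot> t"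
    and mr: "\<And>T t. \<lbrakk>t \<in> hom C T apex; mid \<cdot> t = right \<cdot> t\<rbrakk> \<Longrightarrow> p \<cdot> t = left \<cdot> t"
    and assoc': "\<And>T t1 t2 t3 t4. \<lbrakk>t1 \<in> hom C T apex; t2 \<in> hom C T apex; t3 \<in> hom C T apex; t4 \<in> hom C T apex;
       left \<cdot> t2 = left \<cdot> t3; mid \<cdot> t2 = mid \<cdot> t3; right \<cdot> t2 = p \<cdot> t1; left \<cdot> t1 = right \<cdot> t3;
       left \<cdot> t4 = p \<cdot> t3; mid \<cdot> t4 = mid \<cdot> t1; right \<cdot> t4 = right \<cdot> t1\<rbrakk> \<Longrightarrow> p \<cdot> t2 = p \<cdot> t4"
  shows "is_connector C X r s a b p"
  unfolding is_connector_def
proof (intro conjI allI impI)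
  fix x y z w assume "conn_val C r s a b p x y z w"
  then show "related C s x w" "related C r w z" using rel unfolding conn_val_iff by blast+
next
  fix x y w assume "conn_val C r s a b p x x y w"
  then show "w = y" using lm unfolding conn_val_iff by metis
next
  fix x y w assume "conn_val C r s a b p x y y w"
  then show "w = x" using mr unfolding conn_val_iff by metis
next
  fix x y z u v k l m n
  assume "conn_val C r s a b p z u v k \<and> conn_val C r s a b p x y k l \<and>
    conn_val C r s a b p x y z m \<and> conn_val C r s a b p m u v n"
  then have c: "conn_val C r s a b p z u v k" "conn_val C r s a b p x y k l"
      "conn_val C r s a b p x y z m" "conn_val C r s a b p m u v n" by blast+
  obtain T1 t1 where t1: "t1 \<in> hom C T1 apex" "left \<cdot> t1 = z" "mid \<cdot> t1 = u" "right \<cdot> t1 = v" "p \<cdot> t1 = k"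
    using c(1) unfolding conn_val_iff by blast
  obtain T2 t2 where t2: "t2 \<in> hom C T2 apex" "left \<cdot> t2 = x" "mid \<cdot> t2 = y" "right \<cdot> t2 = k" "p \<cdot> t2 = l"
    using c(2) unfolding conn_val_iff by blast
  obtain T3 t3 where t3: "t3 \<in> hom C T3 apex" "left \<cdot> t3 = x" "mid \<cdot> t3 = y" "right \<cdot> t3 = z" "p \<cdot> t3 = m"
    using c(3) unfolding conn_val_iff by blast
  obtain T4 t4 where t4: "t4 \<in> hom C T4 apex" "left \<cdot> t4 = m" "mid \<cdot> t4 = u" "right \<cdot> t4 = v" "p \<cdot> t4 = n"
    using c(4) unfolding conn_val_iff by blast
  \<comment> \<open>The four partial terms come with domains of their own; coordinates shared
    between the triples force these domains to coincide.\<close>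
  have D: "Dom C (left \<cdot> t) = S" "Dom C (mid \<cdot> t) = S" "Dom C (right \<cdot> t) = S" if "t \<in> hom C S apex" for t S
    using that by (simp_all add: hom_iff)
  have "T3 = T1" using D(3)[OF t3(1)] D(1)[OF t1(1)] t3(4) t1(2) by simp
  moreover have "T2 = T1" using D(2)[OF t2(1)] D(2)[OF t3(1)] t3(3) t2(3) \<open>T3 = T1\<close> by simp
  moreover have "T4 = T1" using D(2)[OF t4(1)] D(2)[OF t1(1)] t4(3) t1(3) by simp
  ultimately have t: "t2 \<in> hom C T1 apex" "t3 \<in> hom C T1 apex" "t4 \<in> hom C T1 apex"
    using t2(1) t3(1) t4(1) by simp_all
  have "p \<cdot> t2 = p \<cdot> t4"
    by (rule assoc'[OF t1(1) t]) (simp_all only: t1 t2 t3 t4)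
  then show "l = n" using t2(5) t4(5) by simp
qed (fact eqv p pb)+

end

section \<open>The comparison between triples over \<open>X\<close> and triples over
  \<open>Y\<close>\<close>

locale connector_image = goursat_category C for C :: "('o, 'a) cat" (structure) +
  fixes X Y :: 'o and f :: 'a and r s fr fs :: "'a \<times> 'a" and er es a b p a' b' :: 'a
  assumes f: "f \<in> hom C X Y" and f_epi: "regular_epi C f"
    and fr: "is_relation C Y Y fr" and fs: "is_relation C Y Y fs"
    and er: "image_map C f r fr er" and es: "image_map C f s fs es"
    and conn: "is_connector C X r s a b p"
    and pb': "is_pullback C (snd fr) (fst fs) a' b'"
begin

lemma r_equiv: "equivalence_relation C X r" and s_equiv: "equivalence_relation C X s"
  and p_hom: "p \<in> hom C (Dom C a) X"
  using conn by (simp_all add: is_connector_def)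

lemma fr_equiv: "equivalence_relation C Y fr"
  by (rule image_equivalence[OF f f_epi r_equiv fr er])

lemma fs_equiv: "equivalence_relation C Y fs"
  by (rule image_equivalence[OF f f_epi s_equiv fs es])

sublocale src: relation_pullback C X r s a b
  using equivalence_relationD[OF r_equiv] equivalence_relationD[OF s_equiv] conn
  by unfold_locales (simp_all add: is_connector_def)

sublocale img: relation_pullback C Y fr fs a' b'
  by unfold_locales (fact fr fs pb')+

lemmas f_simps [simp] = f[unfolded hom_iff] p_hom[unfolded hom_iff]

lemma related_fr: "related C r x y \<Longrightarrow> related C fr (f \<cdot> x) (f \<cdot> y)"
  by (rule related_image[OF f src.r fr er])

lemma related_fs: "related C s x y \<Longrightarrow> related C fs (f \<cdot> x) (f \<cdot> y)"
  by (rule related_image[OF f src.s fs es])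

lemma comparison_exists:
  "\<exists>l\<in>hom C src.apex img.apex. img.left \<cdot> l = f \<cdot> src.left \<and> img.mid \<cdot> l = f \<cdot> src.mid \<and> img.right \<cdot> l = f \<cdot> src.right"
proof -
  \<comment> \<open>The identity of the apex is the generic triple; its image under \<open>f\<close>
    is classified by the comparison arrow.\<close>
  have I: "Idt C src.apex \<in> hom C src.apex src.apex" by (simp add: hom_iff)
  have "related C fr (f \<cdot> src.left) (f \<cdot> src.mid)" "related C fs (f \<cdot> src.mid) (f \<cdot> src.right)"
    using related_fr[OF src.related_left_mid[OF I]] related_fs[OF src.related_mid_right[OF I]] by simp_all
  then obtain l where l: "l \<in> hom C (Dom C (f \<cdot> src.left)) img.apex" "img.left \<cdot> l = f \<cdot> src.left"
      "img.mid \<cdot> l = f \<cdot> src.mid" "img.right \<cdot> l = f \<cdot> src.right"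
    by (rule img.triple_exists)
  then show ?thesis by (intro bexI[of _ l]) simp_all
qed

text \<open>By \<open>img.triple_unique\<close> only one arrow has these coordinates, so the choice
  operator selects nothing arbitrary.\<close>

definition comparison :: 'a where
  "comparison = (SOME l. l \<in> hom C src.apex img.apex \<and>
     img.left \<cdot> l = f \<cdot> src.left \<and> img.mid \<cdot> l = f \<cdot> src.mid \<and> img.right \<cdot> l = f \<cdot> src.right)"

lemma comparison: "comparison \<in> hom C src.apex img.apex" "img.left \<cdot> comparison = f \<cdot> src.left"
    "img.mid \<cdot> comparison = f \<cdot> src.mid" "img.right \<cdot> comparison = f \<cdot> src.right"
  using someI_ex[of "\<lambda>l. l \<in> hom C src.apex img.apex \<and>
     img.left \<cdot> l = f \<cdot> src.left \<and> img.mid \<cdot> l = f \<cdot> src.mid \<and> img.right \<cdot> l = f \<cdot> src.right"] comparison_exists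
  unfolding comparison_def by blast+

lemmas comparison_simps [simp] = comparison(1)[unfolded hom_iff]

lemma comparison_Cmp:
  assumes "t \<in> hom C T src.apex"
  shows "img.left \<cdot> (comparison \<cdot> t) = f \<cdot> (src.left \<cdot> t)" "img.mid \<cdot> (comparison \<cdot> t) = f \<cdot> (src.mid \<cdot> t)"
    "img.right \<cdot> (comparison \<cdot> t) = f \<cdot> (src.right \<cdot> t)"
  using Cmp_extend[OF comparison(2), of t] Cmp_extend[OF comparison(3), of t] Cmp_extend[OF comparison(4), of t] assms
  by (simp_all add: hom_iff assoc)

lemma comparison_eqI:
  assumes t: "t \<in> hom C T src.apex" and u: "u \<in> hom C T img.apex"
    and eq: "f \<cdot> (src.left \<cdot> t) = img.left \<cdot> u" "f \<cdot> (src.mid \<cdot> t) = img.mid \<cdot> u"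
      "f \<cdot> (src.right \<cdot> t) = img.right \<cdot> u"
  shows "comparison \<cdot> t = u"
  by (rule img.triple_unique[OF _ u])
    (use t[unfolded hom_iff] comparison_Cmp[OF t] eq in \<open>simp_all add: hom_iff\<close>)

text \<open>Supplies the natural splittings for \<open>pullback_split_cover\<close>: both
  reflexivity arrows are diagonals, and joint monicity of the legs of \<open>fq\<close> makes them
  compatible with \<open>e\<close>.\<close>

lemma image_map_split:
  assumes rr: "equivalence_relation C X q" and ff: "equivalence_relation C Y fq"
    and e: "image_map C f q fq e"
  obtains d d' where "d \<in> hom C X (Dom C (fst q))" "d' \<in> hom C Y (Dom C (fst fq))"
    "fst q \<cdot> d = Idt C X" "snd q \<cdot> d = Idt C X" "e \<cdot> d = d' \<cdot> f"
proof -
  have e: "regular_epi C e" "Dom C e = Dom C (fst q)" "Cod C e = Dom C (fst fq)"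
      "fst fq \<cdot> e = f \<cdot> fst q" "snd fq \<cdot> e = f \<cdot> snd q"
    using e by (simp_all add: image_map_def)
  note [simp] = relationD[OF equivalence_relationD[OF rr]] relationD[OF equivalence_relationD[OF ff]]
     regular_epi_Ar[OF e(1)] e(2,3)
  obtain d where d: "d \<in> hom C X (Dom C (fst q))" "fst q \<cdot> d = Idt C X" "snd q \<cdot> d = Idt C X"
    using rr unfolding equivalence_relation_def reflexive_relation_def by blast
  obtain d' where d': "d' \<in> hom C Y (Dom C (fst fq))" "fst fq \<cdot> d' = Idt C Y" "snd fq \<cdot> d' = Idt C Y"
    using ff unfolding equivalence_relation_def reflexive_relation_def by blast
  note [simp] = d(1)[unfolded hom_iff] d'(1)[unfolded hom_iff]
  have "e \<cdot> d = d' \<cdot> f"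
    by (rule relation_unique[OF equivalence_relationD[OF ff]])
      (use Cmp_extend[OF e(4), of d] Cmp_extend[OF e(5), of d] Cmp_extend[OF d'(2), of f] Cmp_extend[OF d'(3), of f] d(2,3)
        in \<open>simp_all add: assoc\<close>)
  with d d' that show thesis by blast
qed

text \<open>An instance of \<open>pullback_split_cover\<close>: the legs \<open>snd r\<close> and
  \<open>fst s\<close> are split by reflexivity, and \<open>er\<close>, \<open>f\<close>,
  \<open>es\<close> map this cospan to the one over \<open>Y\<close>.\<close>

lemma comparison_lift:
  assumes u: "u \<in> hom C T img.apex"
  obtains e t where "regular_epi C e" "Cod C e = T" "t \<in> hom C (Dom C e) src.apex" "comparison \<cdot> t = u \<cdot> e"
proof -
  obtain d d' where d: "d \<in> hom C X (Dom C (fst r))" "d' \<in> hom C Y (Dom C (fst fr))"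
    "fst r \<cdot> d = Idt C X" "snd r \<cdot> d = Idt C X" "er \<cdot> d = d' \<cdot> f"
    by (rule image_map_split[OF r_equiv fr_equiv er])
  obtain k k' where k: "k \<in> hom C X (Dom C (fst s))" "k' \<in> hom C Y (Dom C (fst fs))"
    "fst s \<cdot> k = Idt C X" "snd s \<cdot> k = Idt C X" "es \<cdot> k = k' \<cdot> f"
    by (rule image_map_split[OF s_equiv fs_equiv es])
  have R: "regular_epi C er" "Dom C er = Dom C (fst r)" "Cod C er = Dom C (fst fr)"
      "fst fr \<cdot> er = f \<cdot> fst r" "snd fr \<cdot> er = f \<cdot> snd r"
    using er by (simp_all add: image_map_def)
  have S: "regular_epi C es" "Dom C es = Dom C (fst s)" "Cod C es = Dom C (fst fs)"
      "fst fs \<cdot> es = f \<cdot> fst s" "snd fs \<cdot> es = f \<cdot> snd s"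
    using es by (simp_all add: image_map_def)
  note [simp] = u[unfolded hom_iff] regular_epi_Ar[OF R(1)] R(2,3) regular_epi_Ar[OF S(1)] S(2,3)
  have H: "snd r \<in> hom C (Dom C (fst r)) X" "fst s \<in> hom C (Dom C (fst s)) X"
    "snd fr \<in> hom C (Dom C (fst fr)) Y" "fst fs \<in> hom C (Dom C (fst fs)) Y"
    "er \<in> hom C (Dom C (fst r)) (Dom C (fst fr))" "es \<in> hom C (Dom C (fst s)) (Dom C (fst fs))"
    "a' \<cdot> u \<in> hom C T (Dom C (fst fr))" "b' \<cdot> u \<in> hom C T (Dom C (fst fs))"
    by (simp_all add: hom_iff)
  have "snd fr \<cdot> (a' \<cdot> u) = fst fs \<cdot> (b' \<cdot> u)" by (rule pullback_commutes[OF pb']) simp_all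
  then obtain e x z where e: "regular_epi C e" "Cod C e = T" and x: "x \<in> hom C (Dom C e) (Dom C (fst r))"
    and z: "z \<in> hom C (Dom C e) (Dom C (fst s))"
    and xz: "snd r \<cdot> x = fst s \<cdot> z" "er \<cdot> x = (a' \<cdot> u) \<cdot> e" "es \<cdot> z = (b' \<cdot> u) \<cdot> e"
    by (rule pullback_split_cover[OF H(1,2) d(1) k(1) H(3,4) d(2) k(2) H(5) R(1) f H(6) S(1)
      d(4) k(3) R(5) S(4) d(5) k(5) H(7,8)])
  note [simp] = x[unfolded hom_iff] z[unfolded hom_iff] regular_epi_Ar[OF e(1)] e(2)
  have "related C r (fst r \<cdot> x) (snd r \<cdot> x)" by (rule related_intro[of x]) simp_all
  moreover have "related C s (snd r \<cdot> x) (snd s \<cdot> z)" by (rule related_intro[of z]) (simp_all add: xz(1))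
  ultimately obtain t where t: "t \<in> hom C (Dom C (fst r \<cdot> x)) src.apex" "src.left \<cdot> t = fst r \<cdot> x"
      "src.mid \<cdot> t = snd r \<cdot> x" "src.right \<cdot> t = snd s \<cdot> z"
    by (rule src.triple_exists)
  have t': "t \<in> hom C (Dom C e) src.apex" using t(1) by simp
  have ue: "u \<cdot> e \<in> hom C (Dom C e) img.apex" by (simp add: hom_iff)
  have "comparison \<cdot> t = u \<cdot> e"
  proof (rule comparison_eqI[OF t' ue])
    show "f \<cdot> (src.left \<cdot> t) = img.left \<cdot> (u \<cdot> e)"
      using Cmp_extend[OF R(4), of x] xz(2) by (simp add: t(2) img.projections_Cmp(1) assoc)
    show "f \<cdot> (src.mid \<cdot> t) = img.mid \<cdot> (u \<cdot> e)"
      using Cmp_extend[OF R(5), of x] xz(2) by (simp add: t(3) img.projections_Cmp(2) assoc)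
    show "f \<cdot> (src.right \<cdot> t) = img.right \<cdot> (u \<cdot> e)"
      using Cmp_extend[OF S(5), of z] xz(3) by (simp add: t(4) img.projections_Cmp(4) assoc)
  qed
  with e t' that show thesis by blast
qed

text \<open>Lifting the generic triple over \<open>Y\<close> exhibits a cover that factors through
  \<open>comparison\<close>.\<close>

lemma comparison_regular_epi: "regular_epi C comparison"
proof -
  have "Idt C img.apex \<in> hom C img.apex img.apex" by (simp add: hom_iff)
  then obtain e t where e: "regular_epi C e" "Cod C e = img.apex" "t \<in> hom C (Dom C e) src.apex"
      "comparison \<cdot> t = Idt C img.apex \<cdot> e"
    by (rule comparison_lift)
  note [simp] = regular_epi_Ar[OF e(1)] e(2) e(3)[unfolded hom_iff]
  show ?thesis
    by (rule regular_epi_if_covers[OF _ e(1), of _ t]) (use e(4) in simp_all)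
qed

section \<open>Compatibility of the connector with the comparison\<close>

text \<open>Two applications of the shifting property: the first one compares triples
  \<open>(x, y, z)\<close>, \<open>(x, y, z')\<close> with \<open>(y, y, z)\<close>, \<open>(y, y, z')\<close>, and its conclusion is the
  hypothesis on intersections that is needed to compare arbitrary \<open>(x, y, z)\<close>, \<open>(x', y', z')\<close>
  with \<open>(x, y, y)\<close>, \<open>(x', y', y')\<close>.\<close>

lemma connector_respects:
  assumes t: "t \<in> hom C T src.apex" and u: "u \<in> hom C T src.apex" and tu: "comparison \<cdot> t = comparison \<cdot> u"
  shows "f \<cdot> (p \<cdot> t) = f \<cdot> (p \<cdot> u)"
proof -
  \<comment> \<open>\<open>l\<close> remembers the first two coordinates, \<open>m\<close> the last
    two, and \<open>k\<close> the image over \<open>Y\<close> together with the first two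
    coordinates.\<close>
  obtain l where l: "l \<in> Ar C" "Dom C l = src.apex" and lI: "\<And>T x y. \<lbrakk>x \<in> hom C T src.apex; y \<in> hom C T src.apex\<rbrakk>
      \<Longrightarrow> l \<cdot> x = l \<cdot> y \<longleftrightarrow> src.left \<cdot> x = src.left \<cdot> y \<and> src.mid \<cdot> x = src.mid \<cdot> y"
    by (rule pairing_exists[OF src.left_hom src.mid_hom]) metis
  obtain m where m: "m \<in> Ar C" "Dom C m = src.apex" and mI: "\<And>T x y. \<lbrakk>x \<in> hom C T src.apex; y \<in> hom C T src.apex\<rbrakk>
      \<Longrightarrow> m \<cdot> x = m \<cdot> y \<longleftrightarrow> src.mid \<cdot> x = src.mid \<cdot> y \<and> src.right \<cdot> x = src.right \<cdot> y"
    by (rule pairing_exists[OF src.mid_hom src.right_hom]) metis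
  have lh: "l \<in> hom C src.apex (Cod C l)" using l by (simp add: hom_iff)
  obtain k where k: "k \<in> Ar C" "Dom C k = src.apex" and kI: "\<And>T x y. \<lbrakk>x \<in> hom C T src.apex; y \<in> hom C T src.apex\<rbrakk>
      \<Longrightarrow> k \<cdot> x = k \<cdot> y \<longleftrightarrow> comparison \<cdot> x = comparison \<cdot> y \<and> l \<cdot> x = l \<cdot> y"
    by (rule pairing_exists[OF comparison(1) lh]) metis
  have fp: "f \<cdot> p \<in> Ar C" "Dom C (f \<cdot> p) = src.apex" by simp_all
  have fpx: "(f \<cdot> p) \<cdot> x = f \<cdot> (p \<cdot> x)" if "x \<in> hom C T src.apex" for x T
    using that by (simp add: hom_iff assoc)
  have comps: "f \<cdot> (src.left \<cdot> x) = f \<cdot> (src.left \<cdot> y)" "f \<cdot> (src.mid \<cdot> x) = f \<cdot> (src.mid \<cdot> y)"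
    "f \<cdot> (src.right \<cdot> x) = f \<cdot> (src.right \<cdot> y)"
    if "x \<in> hom C T src.apex" "y \<in> hom C T src.apex" "comparison \<cdot> x = comparison \<cdot> y" for x y T
    using comparison_Cmp[OF that(1)] comparison_Cmp[OF that(2)] that(3) by simp_all
  have comparison_eq: "comparison \<cdot> x = comparison \<cdot> y"
    if "x \<in> hom C T src.apex" "y \<in> hom C T src.apex" "f \<cdot> (src.left \<cdot> x) = f \<cdot> (src.left \<cdot> y)"
      "f \<cdot> (src.mid \<cdot> x) = f \<cdot> (src.mid \<cdot> y)" "f \<cdot> (src.right \<cdot> x) = f \<cdot> (src.right \<cdot> y)" for x y T
  proof (rule comparison_eqI[OF that(1)])
    show "comparison \<cdot> y \<in> hom C T img.apex" using that(2) by (simp add: hom_iff)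
  qed (use comparison_Cmp[OF that(2)] that(3-5) in simp_all)
  have mid_left: "\<exists>c\<in>hom C T src.apex. src.left \<cdot> c = src.mid \<cdot> x \<and> src.mid \<cdot> c = src.mid \<cdot> x \<and> src.right \<cdot> c = src.right \<cdot> x"
    if x: "x \<in> hom C T src.apex" for x T
  proof -
    note [simp] = x[unfolded hom_iff]
    have "related C r (src.mid \<cdot> x) (src.mid \<cdot> x)" by (rule related_refl[OF r_equiv]) simp_all
    from src.triple_exists[OF this src.related_mid_right[OF x]] show ?thesis by auto
  qed
  have mid_right: "\<exists>c\<in>hom C T src.apex. src.left \<cdot> c = src.left \<cdot> x \<and> src.mid \<cdot> c = src.mid \<cdot> x \<and> src.right \<cdot> c = src.mid \<cdot> x"
    if x: "x \<in> hom C T src.apex" for x T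
  proof -
    note [simp] = x[unfolded hom_iff]
    have "related C s (src.mid \<cdot> x) (src.mid \<cdot> x)" by (rule related_refl[OF s_equiv]) simp_all
    from src.triple_exists[OF src.related_left_mid[OF x] this] show ?thesis by auto
  qed
  \<comment> \<open>First shift, with \<open>k\<close>, \<open>m\<close> and
    \<open>f \<cdot> p\<close>. On the triples \<open>c\<close> and \<open>d\<close>, whose first
    two coordinates are equal, \<open>p\<close> is the last coordinate, whose value under
    \<open>f\<close> is visible in the comparison.\<close>
  have same_lm: "(f \<cdot> p) \<cdot> x = (f \<cdot> p) \<cdot> y"
    if x: "x \<in> hom C T src.apex" and y: "y \<in> hom C T src.apex"
      and lxy: "comparison \<cdot> x = comparison \<cdot> y" "l \<cdot> x = l \<cdot> y" for x y T
  proof -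
    obtain c where c: "c \<in> hom C T src.apex" "src.left \<cdot> c = src.mid \<cdot> x" "src.mid \<cdot> c = src.mid \<cdot> x"
        "src.right \<cdot> c = src.right \<cdot> x"
      using mid_left[OF x] by blast
    obtain d where d: "d \<in> hom C T src.apex" "src.left \<cdot> d = src.mid \<cdot> y" "src.mid \<cdot> d = src.mid \<cdot> y"
        "src.right \<cdot> d = src.right \<cdot> y"
      using mid_left[OF y] by blast
    note cxy = comps[OF x y lxy(1)] and lm = iffD1[OF lI[OF x y] lxy(2)]
    show ?thesis
    proof (rule shifting[OF k m fp x y c(1) d(1)])
      show "k \<cdot> x = k \<cdot> y" using kI[OF x y] lxy by simp
      have "comparison \<cdot> c = comparison \<cdot> d" by (rule comparison_eq[OF c(1) d(1)]) (simp_all add: c(2-4) d(2-4) cxy)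
      moreover have "l \<cdot> c = l \<cdot> d" using lI[OF c(1) d(1)] lm by (simp add: c(2-4) d(2-4))
      ultimately show "k \<cdot> c = k \<cdot> d" using kI[OF c(1) d(1)] by simp
      show "m \<cdot> x = m \<cdot> c" using mI[OF x c(1)] by (simp add: c(2-4))
      show "m \<cdot> y = m \<cdot> d" using mI[OF y d(1)] by (simp add: d(2-4))
      have "p \<cdot> c = src.right \<cdot> x" using src.is_connectorD(3)[OF conn c(1)] by (simp add: c(2-4))
      moreover have "p \<cdot> d = src.right \<cdot> y" using src.is_connectorD(3)[OF conn d(1)] by (simp add: d(2-4))
      ultimately show "(f \<cdot> p) \<cdot> c = (f \<cdot> p) \<cdot> d" using cxy(3) by (simp add: fpx[OF c(1)] fpx[OF d(1)])
    next
      fix S v w assume v: "v \<in> hom C S src.apex" and w: "w \<in> hom C S src.apex"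
        and vw: "k \<cdot> v = k \<cdot> w" "m \<cdot> v = m \<cdot> w"
      \<comment> \<open>Together \<open>k\<close> and \<open>m\<close> see all three coordinates, so
        the intersection of their kernel pairs is trivial.\<close>
      have "v = w"
        by (rule src.triple_unique[OF v w])
          (use iffD1[OF kI[OF v w] vw(1)] iffD1[OF mI[OF v w] vw(2)] lI[OF v w] in simp_all)
      then show "(f \<cdot> p) \<cdot> v = (f \<cdot> p) \<cdot> w" by simp
    qed
  qed
  obtain c where c: "c \<in> hom C T src.apex" "src.left \<cdot> c = src.left \<cdot> t" "src.mid \<cdot> c = src.mid \<cdot> t"
      "src.right \<cdot> c = src.mid \<cdot> t"
    using mid_right[OF t] by blast
  obtain d where d: "d \<in> hom C T src.apex" "src.left \<cdot> d = src.left \<cdot> u" "src.mid \<cdot> d = src.mid \<cdot> u"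
      "src.right \<cdot> d = src.mid \<cdot> u"
    using mid_right[OF u] by blast
  note ctu = comps[OF t u tu]
  \<comment> \<open>Second shift, with \<open>comparison\<close>, \<open>l\<close> and
    \<open>f \<cdot> p\<close>. On \<open>c\<close> and \<open>d\<close> the last two coordinates
    coincide, so \<open>p\<close> is the first coordinate; the condition on intersections is exactly
    \<open>same_lm\<close>.\<close>
  have comparison_h: "comparison \<in> Ar C" "Dom C comparison = src.apex" by simp_all
  have "(f \<cdot> p) \<cdot> t = (f \<cdot> p) \<cdot> u"
  proof (rule shifting[OF comparison_h l fp t u c(1) d(1) tu])
    show "comparison \<cdot> c = comparison \<cdot> d" by (rule comparison_eq[OF c(1) d(1)]) (simp_all add: c(2-4) d(2-4) ctu)
    show "l \<cdot> t = l \<cdot> c" using lI[OF t c(1)] by (simp add: c(2-4))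
    show "l \<cdot> u = l \<cdot> d" using lI[OF u d(1)] by (simp add: d(2-4))
    have "p \<cdot> c = src.left \<cdot> t" using src.is_connectorD(4)[OF conn c(1)] by (simp add: c(2-4))
    moreover have "p \<cdot> d = src.left \<cdot> u" using src.is_connectorD(4)[OF conn d(1)] by (simp add: d(2-4))
    ultimately show "(f \<cdot> p) \<cdot> c = (f \<cdot> p) \<cdot> d" using ctu(1) by (simp add: fpx[OF c(1)] fpx[OF d(1)])
  qed (rule same_lm)
  then show ?thesis by (simp add: fpx[OF t] fpx[OF u])
qed

section \<open>The connector on the regular images\<close>

text \<open>The diagonal triples form a common section of the first and third projections. They
  commute with the comparison because all coordinates of both sides are \<open>f\<close>.\<close>

lemma comparison_diagonal:
  obtains d d' where "d \<in> hom C X src.apex" "d' \<in> hom C Y img.apex"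
    "src.left \<cdot> d = Idt C X" "src.right \<cdot> d = Idt C X" "comparison \<cdot> d = d' \<cdot> f"
proof -
  have ob: "X \<in> Ob C" "Y \<in> Ob C" using Ob_Dom[of f] Ob_Cod[of f] by simp_all
  note [simp] = ob
  have "related C r (Idt C X) (Idt C X)" "related C s (Idt C X) (Idt C X)"
    by (rule related_refl[OF r_equiv] related_refl[OF s_equiv]; simp)+
  then obtain d where d: "d \<in> hom C (Dom C (Idt C X)) src.apex" "src.left \<cdot> d = Idt C X"
      "src.mid \<cdot> d = Idt C X" "src.right \<cdot> d = Idt C X"
    by (rule src.triple_exists)
  have "related C fr (Idt C Y) (Idt C Y)" "related C fs (Idt C Y) (Idt C Y)"
    by (rule related_refl[OF fr_equiv] related_refl[OF fs_equiv]; simp)+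
  then obtain d' where d': "d' \<in> hom C (Dom C (Idt C Y)) img.apex" "img.left \<cdot> d' = Idt C Y"
      "img.mid \<cdot> d' = Idt C Y" "img.right \<cdot> d' = Idt C Y"
    by (rule img.triple_exists)
  have dh: "d \<in> hom C X src.apex" "d' \<in> hom C Y img.apex" using d(1) d'(1) by simp_all
  note [simp] = dh[unfolded hom_iff]
  have "comparison \<cdot> d = d' \<cdot> f"
    by (rule comparison_eqI[OF dh(1)])
      (use Cmp_extend[OF d'(2), of f] Cmp_extend[OF d'(3), of f] Cmp_extend[OF d'(4), of f]
        in \<open>simp_all add: hom_iff d\<close>)
  with dh d that show thesis by blast
qed

lemma image_connector: "\<exists>q. is_connector C Y fr fs a' b' q"
proof -
  obtain q where q: "q \<in> Ar C" "Dom C q = img.apex" "Cod C q = Y" "q \<cdot> comparison = f \<cdot> p"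
  proof (rule regular_epi_factor[OF comparison_regular_epi, of "f \<cdot> p"])
    fix u v assume uv: "u \<in> Ar C" "v \<in> Ar C" "Cod C u = Dom C comparison" "Cod C v = Dom C comparison"
      "Dom C v = Dom C u" "comparison \<cdot> u = comparison \<cdot> v"
    have "f \<cdot> (p \<cdot> u) = f \<cdot> (p \<cdot> v)"
      by (rule connector_respects[of _ "Dom C u"]) (use uv in \<open>simp_all add: hom_iff\<close>)
    then show "(f \<cdot> p) \<cdot> u = (f \<cdot> p) \<cdot> v" using uv by (simp add: assoc)
  qed simp_all
  note [simp] = q(1-3)
  have qh: "q \<in> hom C img.apex Y" by (simp add: hom_iff)
  have ql: "q \<cdot> (comparison \<cdot> t) = f \<cdot> (p \<cdot> t)" if "t \<in> hom C T src.apex" for t T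
    using Cmp_extend[OF q(4), of t] that by (simp add: hom_iff assoc)
  have "is_connector C Y fr fs a' b' q"
  proof (rule img.is_connectorI[OF fr_equiv fs_equiv qh])
    fix T u assume u: "u \<in> hom C T img.apex"
    obtain e t where e: "regular_epi C e" "Cod C e = T" and t: "t \<in> hom C (Dom C e) src.apex"
      and tu: "comparison \<cdot> t = u \<cdot> e"
      by (rule comparison_lift[OF u])
    note [simp] = regular_epi_Ar[OF e(1)] e(2) u[unfolded hom_iff]
    have v: "(img.left \<cdot> u) \<cdot> e = f \<cdot> (src.left \<cdot> t)" "(img.right \<cdot> u) \<cdot> e = f \<cdot> (src.right \<cdot> t)"
        "(q \<cdot> u) \<cdot> e = f \<cdot> (p \<cdot> t)"
      using comparison_Cmp[OF t] ql[OF t] by (simp_all add: tu assoc)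
    have "related C fs (img.left \<cdot> u) (q \<cdot> u)"
      by (rule related_descend[OF fs e(1)])
        (use related_fs[OF src.is_connectorD(1)[OF conn t]] in \<open>simp_all add: v\<close>)
    moreover have "related C fr (q \<cdot> u) (img.right \<cdot> u)"
      by (rule related_descend[OF fr e(1)])
        (use related_fr[OF src.is_connectorD(2)[OF conn t]] in \<open>simp_all add: v\<close>)
    ultimately show "related C fs (img.left \<cdot> u) (q \<cdot> u) \<and> related C fr (q \<cdot> u) (img.right \<cdot> u)" ..
  next
    fix T u assume u: "u \<in> hom C T img.apex" and lm: "img.left \<cdot> u = img.mid \<cdot> u"
    note [simp] = u[unfolded hom_iff]
    \<comment> \<open>A lift of \<open>u\<close> along the comparison need not have equal first and
      second coordinates. Only the pair \<open>(mid, right)\<close> is lifted, and its first entry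
      is repeated to form \<open>(y, y, z)\<close>.\<close>
    obtain e y z where e: "regular_epi C e" "Cod C e = Dom C (img.mid \<cdot> u)" and yz: "related C s y z"
      "f \<cdot> y = (img.mid \<cdot> u) \<cdot> e" "f \<cdot> z = (img.right \<cdot> u) \<cdot> e" "Dom C y = Dom C e"
      by (rule related_image_lift[OF f src.s fs es img.related_mid_right[OF u]])
    have eT: "Cod C e = T" using e(2) by simp
    note [simp] = regular_epi_Ar[OF e(1)] eT relatedD[OF src.s yz(1)] yz(4)
    have "related C r y y" by (rule related_refl[OF r_equiv]) simp_all
    from src.triple_exists[OF this yz(1)] obtain t where
      t: "t \<in> hom C (Dom C e) src.apex" "src.left \<cdot> t = y" "src.mid \<cdot> t = y" "src.right \<cdot> t = z"
      by auto
    have "comparison \<cdot> t = u \<cdot> e"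
      by (rule comparison_eqI[OF t(1)]) (use yz(2,3) lm Cmp_extend[OF lm, of e] in \<open>simp_all add: hom_iff t(2-4) assoc\<close>)
    then have "(q \<cdot> u) \<cdot> e = f \<cdot> (p \<cdot> t)" using ql[OF t(1)] by (simp add: assoc)
    also have "\<dots> = (img.right \<cdot> u) \<cdot> e" using src.is_connectorD(3)[OF conn t(1)] yz(3) by (simp add: t(2-4))
    finally show "q \<cdot> u = img.right \<cdot> u" by - (rule regular_epi_cancel[OF e(1)], simp_all)
  next
    fix T u assume u: "u \<in> hom C T img.apex" and mr: "img.mid \<cdot> u = img.right \<cdot> u"
    note [simp] = u[unfolded hom_iff]
    \<comment> \<open>Symmetrically, only the pair \<open>(left, mid)\<close> is lifted, and its
      second entry is repeated.\<close>
    obtain e x y where e: "regular_epi C e" "Cod C e = Dom C (img.left \<cdot> u)" and xy: "related C r x y"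
      "f \<cdot> x = (img.left \<cdot> u) \<cdot> e" "f \<cdot> y = (img.mid \<cdot> u) \<cdot> e" "Dom C x = Dom C e"
      by (rule related_image_lift[OF f src.r fr er img.related_left_mid[OF u]])
    have eT: "Cod C e = T" using e(2) by simp
    note [simp] = regular_epi_Ar[OF e(1)] eT relatedD[OF src.r xy(1)] xy(4)
    have "related C s y y" by (rule related_refl[OF s_equiv]) simp_all
    from src.triple_exists[OF xy(1) this] obtain t where
      t: "t \<in> hom C (Dom C e) src.apex" "src.left \<cdot> t = x" "src.mid \<cdot> t = y" "src.right \<cdot> t = y"
      by auto
    have "comparison \<cdot> t = u \<cdot> e"
      by (rule comparison_eqI[OF t(1)]) (use xy(2,3) Cmp_extend[OF mr, of e] in \<open>simp_all add: hom_iff t(2-4) assoc\<close>)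
    then have "(q \<cdot> u) \<cdot> e = f \<cdot> (p \<cdot> t)" using ql[OF t(1)] by (simp add: assoc)
    also have "\<dots> = (img.left \<cdot> u) \<cdot> e" using src.is_connectorD(4)[OF conn t(1)] xy(2) by (simp add: t(2-4))
    finally show "q \<cdot> u = img.left \<cdot> u" by - (rule regular_epi_cancel[OF e(1)], simp_all)
  next
    fix T u1 u2 u3 u4
    assume u1: "u1 \<in> hom C T img.apex" and u2: "u2 \<in> hom C T img.apex"
      and u3: "u3 \<in> hom C T img.apex" and u4: "u4 \<in> hom C T img.apex"
      and eq: "img.left \<cdot> u2 = img.left \<cdot> u3" "img.mid \<cdot> u2 = img.mid \<cdot> u3" "img.right \<cdot> u2 = q \<cdot> u1"
        "img.left \<cdot> u1 = img.right \<cdot> u3"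
        "img.left \<cdot> u4 = q \<cdot> u3" "img.mid \<cdot> u4 = img.mid \<cdot> u1" "img.right \<cdot> u4 = img.right \<cdot> u1"
    obtain d d' where d: "d \<in> hom C X src.apex" "d' \<in> hom C Y img.apex"
      "src.left \<cdot> d = Idt C X" "src.right \<cdot> d = Idt C X" "comparison \<cdot> d = d' \<cdot> f"
      by (rule comparison_diagonal)
    \<comment> \<open>With \<open>u3 = (x,y,z)\<close> and \<open>u1 = (z,u,v)\<close>, independent
      lifts could disagree in \<open>z\<close>. The split pullback of the third and first
      projections gives lifts that share it.\<close>
    obtain e t3 t1 where e: "regular_epi C e" "Cod C e = T"
      and t3: "t3 \<in> hom C (Dom C e) src.apex" and t1: "t1 \<in> hom C (Dom C e) src.apex"
      and t31: "src.right \<cdot> t3 = src.left \<cdot> t1" and l3: "comparison \<cdot> t3 = u3 \<cdot> e" and l1: "comparison \<cdot> t1 = u1 \<cdot> e"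
      by (rule pullback_split_cover[OF src.right_hom src.left_hom d(1,1) img.right_hom img.left_hom
          d(2,2) comparison(1) comparison_regular_epi f comparison(1) comparison_regular_epi d(4,3) comparison(4) comparison(2) d(5,5) u3 u1 eq(4)[symmetric]])
    note [simp] = regular_epi_Ar[OF e(1)] e(2) u1[unfolded hom_iff] u2[unfolded hom_iff]
      u3[unfolded hom_iff] u4[unfolded hom_iff] t1[unfolded hom_iff] t3[unfolded hom_iff]
    \<comment> \<open>The triples \<open>t2\<close> and \<open>t4\<close> are not lifted but built
      over \<open>X\<close>: transitivity through the shared entry makes
      \<open>p(x,y,p(z,u,v))\<close> and \<open>p(p(x,y,z),u,v)\<close> defined there.\<close>
    have "related C s (src.mid \<cdot> t3) (p \<cdot> t1)"
      using related_trans[OF s_equiv src.related_mid_right[OF t3]] src.is_connectorD(1)[OF conn t1]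
      by (simp add: t31)
    from src.triple_exists[OF src.related_left_mid[OF t3] this] obtain t2 where
      t2: "t2 \<in> hom C (Dom C e) src.apex" "src.left \<cdot> t2 = src.left \<cdot> t3" "src.mid \<cdot> t2 = src.mid \<cdot> t3"
        "src.right \<cdot> t2 = p \<cdot> t1"
      by auto
    have "related C r (p \<cdot> t3) (src.mid \<cdot> t1)"
      using related_trans[OF r_equiv src.is_connectorD(2)[OF conn t3]] src.related_left_mid[OF t1]
      by (simp add: t31)
    from src.triple_exists[OF this src.related_mid_right[OF t1]] obtain t4 where
      t4: "t4 \<in> hom C (Dom C e) src.apex" "src.left \<cdot> t4 = p \<cdot> t3" "src.mid \<cdot> t4 = src.mid \<cdot> t1"
        "src.right \<cdot> t4 = src.right \<cdot> t1"
      by auto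
    have pp: "p \<cdot> t2 = p \<cdot> t4"
      by (rule src.is_connector_assoc[OF conn t1 t2(1) t3 t4(1) t2(2-4) t31[symmetric] t4(2-4)])
    have c3: "f \<cdot> (src.left \<cdot> t3) = img.left \<cdot> (u3 \<cdot> e)" "f \<cdot> (src.mid \<cdot> t3) = img.mid \<cdot> (u3 \<cdot> e)"
        "f \<cdot> (p \<cdot> t3) = q \<cdot> (u3 \<cdot> e)"
      using comparison_Cmp[OF t3] ql[OF t3] by (simp_all add: l3)
    have c1: "f \<cdot> (src.mid \<cdot> t1) = img.mid \<cdot> (u1 \<cdot> e)" "f \<cdot> (src.right \<cdot> t1) = img.right \<cdot> (u1 \<cdot> e)"
        "f \<cdot> (p \<cdot> t1) = q \<cdot> (u1 \<cdot> e)"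
      using comparison_Cmp[OF t1] ql[OF t1] by (simp_all add: l1)
    \<comment> \<open>That the built triples lie over \<open>u2\<close> and \<open>u4\<close> is
      read off from their coordinates, using the values of \<open>q\<close> already known on
      \<open>u1\<close> and \<open>u3\<close>.\<close>
    have "comparison \<cdot> t2 = u2 \<cdot> e"
      by (rule comparison_eqI[OF t2(1)])
        (use Cmp_extend[OF eq(1), of e] Cmp_extend[OF eq(2), of e] Cmp_extend[OF eq(3), of e]
          in \<open>simp_all add: hom_iff t2(2-4) c1 c3 assoc\<close>)
    then have q2: "q \<cdot> (u2 \<cdot> e) = f \<cdot> (p \<cdot> t2)" using ql[OF t2(1)] by simp
    have "comparison \<cdot> t4 = u4 \<cdot> e"
      by (rule comparison_eqI[OF t4(1)])
        (use Cmp_extend[OF eq(5), of e] Cmp_extend[OF eq(6), of e] Cmp_extend[OF eq(7), of e]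
          in \<open>simp_all add: hom_iff t4(2-4) c1 c3 assoc\<close>)
    then have "q \<cdot> (u4 \<cdot> e) = f \<cdot> (p \<cdot> t4)" using ql[OF t4(1)] by simp
    with q2 have "(q \<cdot> u2) \<cdot> e = (q \<cdot> u4) \<cdot> e" by (simp add: assoc pp)
    then show "q \<cdot> u2 = q \<cdot> u4" by - (rule regular_epi_cancel[OF e(1)], simp_all)
  qed
  then show ?thesis ..
qed

end

theorem proposition3p7:
  fixes C :: "('o, 'a) cat" and X Y :: 'o and f :: 'a and r s fr fs :: "'a \<times> 'a"
  assumes "goursat_category C"
    and "equivalence_relation C X r"
    and "equivalence_relation C X s"
    and "f \<in> hom C X Y"
    and "regular_epi C f"
    and "is_regular_image C f r fr"
    and "is_regular_image C f s fs"
    and "has_connector C X r s"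
  shows "has_connector C Y fr fs"
proof -
  interpret goursat_category C by fact
  obtain er where er: "is_relation C Y Y fr" "image_map C f r fr er"
    using regular_image_span[OF assms(6) equivalence_relationD[OF assms(2)] assms(4)]
    unfolding image_map_def by metis
  obtain es where es: "is_relation C Y Y fs" "image_map C f s fs es"
    using regular_image_span[OF assms(7) equivalence_relationD[OF assms(3)] assms(4)]
    unfolding image_map_def by metis
  obtain a b p where conn: "is_connector C X r s a b p"
    using assms(8) unfolding has_connector_def by blast
  have "Cod C (fst fs) = Cod C (snd fr)" using relationD[OF er(1)] relationD[OF es(1)] by simp
  \<comment> \<open>A connector may be given on any choice of pullback of the image legs, so an
    arbitrary one is fixed here.\<close>
  then obtain a' b' where pb': "is_pullback C (snd fr) (fst fs) a' b'"
    using pullback_exists[OF relationD(2)[OF er(1)] relationD(1)[OF es(1)]] by metis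
  interpret connector_image C X Y f r s fr fs er es a b p a' b'
    by unfold_locales (fact assms(4,5) er es conn pb')+
  show ?thesis unfolding has_connector_def using image_connector by blast
qed

end
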